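(* Let $d \geq 3$ and $k \geq 1$ be fixed integers. Consider the $d$-uniform random hypergraph process $\{H_d(n,\mu)\}_{\mu=0}^{\binom{n}{d}}$ on vertex set $[n]$. Let $\tau_k$ be the first time $\mu$ at which $H_d(n,\mu)$ has minimum degree at least $k$, and let $T_k$ be the first time $\mu$ at which $H_d(n,\mu)$ is $k$-connected. Then $P(\tau_k = T_k) \to 1$ as $n \to \infty$.
   Context: The $d$-uniform random hypergraph process on $[n]=\{1,\dots,n\}$ starts with $H_d(n,0)$ having no edges, and $H_d(n,\mu+1)$ is obtained from $H_d(n,\mu)$ by adding one edge (a $d$-element subset of $[n]$) chosen uniformly at random among the $\binom{n}{d}-\mu$ $d$-subsets not yet present. The degree of a vertex is the number of edges containing it. A hypergraph with more than $k$ vertices is $k$-connected if whenever any $k-1$ vertices are deleted, together with all edges incident to them, the remaining hypergraph is connected (two vertices lie in the same component if they are joined by a sequence of edges, consecutive ones intersecting). *)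

theory Defs
  imports "HOL-Probability.Probability" "HOL-Library.Extended_Nat"
begin

definition all_edges :: "nat \<Rightarrow> nat \<Rightarrow> nat set set" where
  "all_edges d n = {e. e \<subseteq> {1..n} \<and> card e = d}"

definition hg_degree :: "'a set set \<Rightarrow> 'a \<Rightarrow> nat" where
  "hg_degree E v = card {e \<in> E. v \<in> e}"

definition hg_min_degree :: "'a set \<Rightarrow> 'a set set \<Rightarrow> nat" where
  "hg_min_degree V E = Min (hg_degree E ` V)"

text \<open>A vertex lies in its own component even if no edge contains it; hence the disjunct
  \<open>u = v\<close>.\<close>

definition same_component :: "'a set set \<Rightarrow> 'a \<Rightarrow> 'a \<Rightarrow> bool" where
  "same_component E u v \<longleftrightarrow> u = v \<or>
     (\<exists>es. es \<noteq> [] \<and> set es \<subseteq> E \<and> u \<in> hd es \<and> v \<in> last es \<and>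
           successively (\<lambda>e f. e \<inter> f \<noteq> {}) es)"

definition hg_connected :: "'a set \<Rightarrow> 'a set set \<Rightarrow> bool" where
  "hg_connected V E \<longleftrightarrow> (\<forall>u\<in>V. \<forall>v\<in>V. same_component E u v)"

definition k_connected :: "nat \<Rightarrow> 'a set \<Rightarrow> 'a set set \<Rightarrow> bool" where
  "k_connected k V E \<longleftrightarrow> k < card V \<and>
     (\<forall>S\<subseteq>V. card S = k - 1 \<longrightarrow> hg_connected (V - S) {e \<in> E. e \<inter> S = {}})"

text \<open>A trajectory of the process is recorded as the list of edges in order of arrival.
  The set from which the next edge is drawn is nonempty for the first \<open>n choose d\<close> steps,
  which are the only ones used below.\<close>

primrec process_steps :: "nat \<Rightarrow> nat \<Rightarrow> nat \<Rightarrow> nat set list pmf" where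
  "process_steps d n 0 = return_pmf []"
| "process_steps d n (Suc m) =
     bind_pmf (process_steps d n m) (\<lambda>es.
       map_pmf (\<lambda>e. es @ [e]) (pmf_of_set (all_edges d n - set es)))"

definition hypergraph_process :: "nat \<Rightarrow> nat \<Rightarrow> nat set list pmf" where
  "hypergraph_process d n = process_steps d n (n choose d)"

definition hypergraph_at :: "nat set list \<Rightarrow> nat \<Rightarrow> nat set set" where
  "hypergraph_at es \<mu> = set (take \<mu> es)"

text \<open>First times are extended naturals: the value is \<open>\<infinity>\<close> if the property is never
  attained, which can occur only when \<open>n\<close> is small compared with \<open>d\<close> and \<open>k\<close>.\<close>

definition first_time :: "nat set list \<Rightarrow> (nat set set \<Rightarrow> bool) \<Rightarrow> enat" where
  "first_time es P = Inf (enat ` {\<mu>. \<mu> \<le> length es \<and> P (hypergraph_at es \<mu>)})"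

definition tau :: "nat \<Rightarrow> nat \<Rightarrow> nat set list \<Rightarrow> enat" where
  "tau k n es = first_time es (\<lambda>E. k \<le> hg_min_degree {1..n} E)"

definition T_conn :: "nat \<Rightarrow> nat \<Rightarrow> nat set list \<Rightarrow> enat" where
  "T_conn k n es = first_time es (\<lambda>E. k_connected k {1..n} E)"

end

theory Submission
  imports Defs "HOL-Real_Asymp.Real_Asymp"
begin

text \<open>
  Compare the process with two deterministic times \<open>m_lo < m_hi\<close> of order \<open>n ln n\<close> that enclose
  \<open>tau\<close> with high probability: at \<open>m_lo\<close> some vertex is still isolated (second moment), and at
  \<open>m_hi\<close> all degrees are at least \<open>k\<close>. Call a vertex low if its degree at \<open>m_lo\<close> is bounded by a
  constant. With high probability, at \<open>m_hi\<close> no two vertices share more than two edges, a low vertex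
  shares at most one edge with any other vertex, low vertices are at distance more than two, and sets
  of \<open>a \<le> n / ln n\<close> vertices span fewer than \<open>2 a\<close> edges, whereas already at \<open>m_lo\<close> every larger set
  of at most half the vertices is joined to the rest after deletion of any \<open>k - 1\<close> vertices. If at a
  time in between all degrees are at least \<open>k\<close> and deleting \<open>k - 1\<close> vertices splits off a set \<open>A\<close>,
  where \<open>A\<close> is the smaller side, then \<open>A\<close> has at most \<open>n / ln n\<close> vertices. The codegree
  bounds exclude isolated vertices, so each low vertex of \<open>A\<close> has a private pair of neighbours in \<open>A\<close>
  that are not low; hence two thirds of \<open>A\<close> are not low and \<open>A\<close> spans too many edges. The
  converse inequality is deterministic: a vertex of degree less than \<open>k\<close> can be cut off.
\<close>

section \<open>The process as a uniformly random permutation\<close>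

text \<open>Nothing is estimated at the random time itself. Properties that ask for edges are
  required at \<open>m_lo\<close> and properties that limit edges at \<open>m_hi\<close>; both pass
  to every time in between, so no union bound over times occurs. The obstacle is a vertex whose
  degree is barely \<open>k\<close>: deleting \<open>k - 1\<close> vertices could isolate it, and
  codegree at most 2, which is all that is available for general pairs, does not prevent this. Such
  vertices are rare, each vertex being low with probability at most n^(-3/4) up to logarithms, and
  this pays for the stronger conditions imposed on them. The rank d \<ge> 3 enters twice: an edge at
  a low vertex has at least two further vertices, and the exponent of a / n in the sparsity count is
  2 (d - 1) - 1 \<ge> 3. The threshold n / ln n suits both regimes: below it (ln n)^2 (a / n)^3 is
  at most 1 / ln n, and above it there are at most (e ln n)^a sets of size a, while a given one is
  cut off with probability at most exp (- g a ln n) for a constant g.\<close>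

lemma finite_all_edges [simp]: "finite (all_edges d n)"
  unfolding all_edges_def by (rule finite_subset[of _ "Pow {1..n}"]) auto

lemma card_all_edges: "card (all_edges d n) = n choose d"
  unfolding all_edges_def using n_subsets[of "{1..n}" d] by simp

text \<open>All distinct lists of length \<open>m\<close> have the same number
  \<open>(n choose d) - m\<close> of one-edge extensions, and different lists have different
  extensions. A uniform choice of a block followed by a uniform choice inside it is uniform when the
  blocks are disjoint and of equal size.\<close>

lemma process_steps_eq_pmf_of_set:
  assumes "m \<le> n choose d"
  shows "process_steps d n m =
    pmf_of_set {xs. length xs = m \<and> distinct xs \<and> set xs \<subseteq> all_edges d n}"
  using assms
proof (induction m)
  case 0
  have "{xs. length xs = 0 \<and> distinct xs \<and> set xs \<subseteq> all_edges d n} = {[]}"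
    by auto
  then show ?case
    by (simp add: pmf_of_set_singleton)
next
  case (Suc m)
  define E where "E = all_edges d n"
  define A where "A = (\<lambda>m. {xs. length xs = m \<and> distinct xs \<and> set xs \<subseteq> E})"
  have E: "finite E" "card E = n choose d"
    by (auto simp: E_def card_all_edges)
  have fin: "finite (A m)" for m
    unfolding A_def by (rule finite_subset[OF _ finite_lists_length_eq[OF E(1), of m]]) auto
  have card_rest: "card (E - set xs) = (n choose d) - m" if "xs \<in> A m" for xs
    using that E by (subst card_Diff_subset) (auto simp: A_def distinct_card)
  have nonempty: "A m \<noteq> {}"
  proof -
    obtain xs where "set xs = E" "distinct xs"
      using finite_distinct_list[OF E(1)] by blast
    moreover from this have "length xs = n choose d"
      using E distinct_card by metis
    ultimately have "take m xs \<in> A m"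
      using Suc.prems set_take_subset[of m xs] by (simp add: A_def)
    then show ?thesis by blast
  qed
  define f where "f = (\<lambda>xs. (\<lambda>e. xs @ [e]) ` (E - set xs))"
  \<comment> \<open>Here the bound \<open>Suc m \<le> n choose d\<close> enters: the next edge is
    drawn from a nonempty set.\<close>
  have rest: "E - set xs \<noteq> {}" if "xs \<in> A m" for xs
    using card_rest[OF that] Suc.prems by (metis card.empty Suc_le_lessD zero_less_diff less_not_refl)
  have UN: "A (Suc m) = (\<Union>xs\<in>A m. f xs)"
  proof (rule antisym; rule subsetI)
    fix ys assume ys: "ys \<in> A (Suc m)"
    then obtain xs e where "ys = xs @ [e]"
      by (cases ys rule: rev_cases) (auto simp: A_def)
    with ys show "ys \<in> (\<Union>xs\<in>A m. f xs)"
      by (auto simp: A_def f_def)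
  qed (auto simp: A_def f_def)
  have "process_steps d n (Suc m) = pmf_of_set (A m) \<bind> (\<lambda>xs. pmf_of_set (f xs))"
  proof -
    have "map_pmf (\<lambda>e. xs @ [e]) (pmf_of_set (E - set xs)) = pmf_of_set (f xs)" if "xs \<in> A m" for xs
      unfolding f_def using rest[OF that] E by (intro map_pmf_of_set_inj) (auto simp: inj_on_def)
    moreover have "process_steps d n m = pmf_of_set (A m)"
      using Suc unfolding A_def E_def by simp
    ultimately show ?thesis
      using set_pmf_of_set[OF nonempty fin]
      by (auto simp: E_def[symmetric] intro!: bind_pmf_cong[OF refl])
  qed
  also have "\<dots> = pmf_of_set (A (Suc m))"
    unfolding UN
  proof (rule pmf_of_set_UN[symmetric])
    show "finite (\<Union> (f ` A m))" using UN fin by metis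
    show "card (f xs) = (n choose d) - m" if "xs \<in> A m" for xs
      using card_rest[OF that] unfolding f_def by (subst card_image) (auto simp: inj_on_def)
    show "f xs \<noteq> {}" if "xs \<in> A m" for xs using rest[OF that] by (simp add: f_def)
  qed (use nonempty in \<open>auto simp: disjoint_family_on_def f_def\<close>)
  finally show ?case by (simp add: A_def E_def)
qed

lemma hypergraph_process_eq_pmf_of_set:
  "hypergraph_process d n = pmf_of_set (permutations_of_set (all_edges d n))"
proof -
  have "set xs = all_edges d n"
    if "length xs = n choose d" "distinct xs" "set xs \<subseteq> all_edges d n" for xs
    using that by (intro card_subset_eq) (auto simp: distinct_card card_all_edges)
  then have "{xs. length xs = n choose d \<and> distinct xs \<and> set xs \<subseteq> all_edges d n} =
    permutations_of_set (all_edges d n)"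
    by (auto simp: permutations_of_set_def card_all_edges[symmetric] dest: distinct_card)
  then show ?thesis
    by (simp add: hypergraph_process_def process_steps_eq_pmf_of_set)
qed

text \<open>A counting ratio for an arbitrary ground set: the recursions below delete elements of
  \<open>E\<close>, so the probability cannot be tied to \<open>all_edges d n\<close>. For finite
  \<open>E\<close> the denominator is the number of permutations.\<close>

definition perm_prob :: "'a set \<Rightarrow> ('a list \<Rightarrow> bool) \<Rightarrow> real" where
  "perm_prob E Q = card {xs \<in> permutations_of_set E. Q xs} / fact (card E)"

lemma prob_hypergraph_process:
  "measure_pmf.prob (hypergraph_process d n) {es. Q es} = perm_prob (all_edges d n) Q"
  unfolding hypergraph_process_eq_pmf_of_set perm_prob_def
  by (subst measure_pmf_of_set) (auto simp: Int_def)

section \<open>Basic rules for probabilities under a uniform permutation\<close>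

lemma perm_prob_nonneg: "0 \<le> perm_prob E Q"
  by (simp add: perm_prob_def)

lemma perm_prob_mono:
  assumes "\<And>xs. xs \<in> permutations_of_set E \<Longrightarrow> Q xs \<Longrightarrow> R xs"
  shows "perm_prob E Q \<le> perm_prob E R"
  using assms unfolding perm_prob_def
  by (intro divide_right_mono of_nat_mono card_mono) auto

lemma perm_prob_cong:
  assumes "\<And>xs. xs \<in> permutations_of_set E \<Longrightarrow> Q xs \<longleftrightarrow> R xs"
  shows "perm_prob E Q = perm_prob E R"
  using assms by (intro antisym perm_prob_mono) auto

lemma perm_prob_not:
  assumes "finite E"
  shows "perm_prob E (\<lambda>xs. \<not> Q xs) = 1 - perm_prob E Q"
proof -
  have "permutations_of_set E =
      {xs \<in> permutations_of_set E. Q xs} \<union> {xs \<in> permutations_of_set E. \<not> Q xs}"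
    by auto
  then have "card (permutations_of_set E) =
      card ({xs \<in> permutations_of_set E. Q xs} \<union> {xs \<in> permutations_of_set E. \<not> Q xs})"
    by simp
  also have "\<dots> = card {xs \<in> permutations_of_set E. Q xs} + card {xs \<in> permutations_of_set E. \<not> Q xs}"
    by (intro card_Un_disjoint) auto
  finally have "fact (card E) = card {xs \<in> permutations_of_set E. Q xs} +
      card {xs \<in> permutations_of_set E. \<not> Q xs}"
    using assms by simp
  from arg_cong[OF this, of real]
  have *: "real (card {xs \<in> permutations_of_set E. Q xs}) +
      real (card {xs \<in> permutations_of_set E. \<not> Q xs}) = fact (card E)"
    by simp
  have "1 = perm_prob E Q + perm_prob E (\<lambda>xs. \<not> Q xs)"
    unfolding perm_prob_def add_divide_distrib[symmetric] * by simp
  then show ?thesis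
    by simp
qed

lemma perm_prob_Bex:
  assumes "finite I"
  shows "perm_prob E (\<lambda>xs. \<exists>i\<in>I. Q i xs) \<le> (\<Sum>i\<in>I. perm_prob E (Q i))"
proof -
  have "{xs \<in> permutations_of_set E. \<exists>i\<in>I. Q i xs} = (\<Union>i\<in>I. {xs \<in> permutations_of_set E. Q i xs})"
    by auto
  then have "card {xs \<in> permutations_of_set E. \<exists>i\<in>I. Q i xs} \<le>
      (\<Sum>i\<in>I. card {xs \<in> permutations_of_set E. Q i xs})"
    using card_UN_le[OF assms] by metis
  then show ?thesis
    unfolding perm_prob_def sum_divide_distrib[symmetric]
    by (intro divide_right_mono) (simp_all flip: of_nat_sum del: of_nat_sum)
qed

text \<open>The bound \<open>b\<close> may itself come from this rule, so a chain of dependent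
  quantifiers is handled by applying the rule once per quantifier, and the numbers of choices
  multiply.\<close>

lemma perm_prob_Bex_le:
  assumes "finite I" "\<And>i. i \<in> I \<Longrightarrow> perm_prob E (Q i) \<le> b" "real (card I) \<le> c" "0 \<le> b"
  shows "perm_prob E (\<lambda>xs. \<exists>i\<in>I. Q i xs) \<le> c * b"
proof -
  have "perm_prob E (\<lambda>xs. \<exists>i\<in>I. Q i xs) \<le> (\<Sum>i\<in>I. perm_prob E (Q i))"
    by (rule perm_prob_Bex[OF assms(1)])
  also have "\<dots> \<le> real (card I) * b"
    using assms(2) by (rule sum_bounded_above)
  also have "\<dots> \<le> c * b"
    using assms by (intro mult_right_mono)
  finally show ?thesis .
qed

lemma perm_prob_Cons:
  assumes "finite E" "E \<noteq> {}"
  shows "perm_prob E Q = (\<Sum>e\<in>E. perm_prob (E - {e}) (\<lambda>xs. Q (e # xs))) / card E"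
proof -
  have "{xs \<in> permutations_of_set E. Q xs} =
      (\<Union>e\<in>E. (#) e ` {xs \<in> permutations_of_set (E - {e}). Q (e # xs)})"
    by (subst permutations_of_set_nonempty[OF assms(2)]) auto
  also have "card \<dots> = (\<Sum>e\<in>E. card {xs \<in> permutations_of_set (E - {e}). Q (e # xs)})"
    using assms by (subst card_UN_disjoint) (auto simp: card_image)
  finally have "real (card {xs \<in> permutations_of_set E. Q xs}) =
      (\<Sum>e\<in>E. real (card {xs \<in> permutations_of_set (E - {e}). Q (e # xs)}))"
    by simp
  moreover have "fact (card E) = card E * (fact (card E - 1) :: real)"
    using assms by (intro fact_reduce) (simp add: card_gt_0_iff)
  ultimately show ?thesis
    using assms by (simp add: perm_prob_def sum_divide_distrib mult.commute)
qed

text \<open>Conditioning on the first entry gives a recursion on the ground set. Truncated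
  subtraction makes the formula right for large \<open>m\<close>: if fewer than \<open>m\<close>
  elements lie outside \<open>F\<close>, one factor is 0. The second moment argument needs this
  exact value and not just a bound.\<close>

lemma perm_prob_avoid:
  assumes "finite E" "F \<subseteq> E" "m \<le> card E"
  shows "perm_prob E (\<lambda>xs. F \<inter> set (take m xs) = {}) =
    (\<Prod>i<m. real (card E - card F - i) / real (card E - i))"
  using assms
proof (induction m arbitrary: E)
  case 0
  then show ?case by (simp add: perm_prob_def)
next
  case (Suc m)
  have ne: "E \<noteq> {}" using Suc.prems by auto
  have "perm_prob (E - {e}) (\<lambda>xs. F \<inter> set (take (Suc m) (e # xs)) = {}) =
      (if e \<in> F then 0 else (\<Prod>i<m. real (card E - card F - Suc i) / real (card E - Suc i)))"
    if "e \<in> E" for e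
  proof (cases "e \<in> F")
    case True
    then show ?thesis by (simp add: perm_prob_def)
  next
    case False
    then have "perm_prob (E - {e}) (\<lambda>xs. F \<inter> set (take (Suc m) (e # xs)) = {}) =
      perm_prob (E - {e}) (\<lambda>xs. F \<inter> set (take m xs) = {})"
      by (intro perm_prob_cong) auto
    also have "\<dots> = (\<Prod>i<m. real (card E - Suc 0 - card F - i) / real (card E - Suc 0 - i))"
      using Suc.prems False that by (subst Suc.IH) auto
    finally show ?thesis using False by (simp add: diff_diff_eq add.commute)
  qed
  then have "perm_prob E (\<lambda>xs. F \<inter> set (take (Suc m) xs) = {}) =
    (\<Sum>e\<in>E. if e \<in> F then 0 else (\<Prod>i<m. real (card E - card F - Suc i) / real (card E - Suc i)))
     / card E"
    by (subst perm_prob_Cons[OF Suc.prems(1) ne]) simp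
  also have "(\<Sum>e\<in>E. if e \<in> F then 0 else (\<Prod>i<m. real (card E - card F - Suc i) / real (card E - Suc i)))
    = (card E - card F) * (\<Prod>i<m. real (card E - card F - Suc i) / real (card E - Suc i))"
    using Suc.prems finite_subset[of F E]
    by (simp add: sum.If_cases card_Diff_subset flip: Diff_eq)
  finally show ?case
    by (simp only: prod.lessThan_Suc_shift) simp
qed

text \<open>Drawing without replacement makes avoidance harder at every step: the factors are
  largest at index 0.\<close>

lemma perm_prob_avoid_le:
  assumes "finite E" "F \<subseteq> E" "m \<le> card E"
  shows "perm_prob E (\<lambda>xs. F \<inter> set (take m xs) = {}) \<le> (1 - card F / card E) ^ m"
proof -
  have F: "card F \<le> card E" using assms card_mono by blast
  have "(\<Prod>i<m. real (card E - card F - i) / real (card E - i)) \<le> (\<Prod>i<m. 1 - card F / card E)"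
  proof (intro prod_mono conjI)
    fix i assume "i \<in> {..<m}"
    then have i: "i < card E" using assms by auto
    show "real (card E - card F - i) / real (card E - i) \<le> 1 - card F / card E"
    proof (cases "i \<le> card E - card F")
      case True
      then have "real (card E - card F - i) = real (card E) - card F - i" 
        using F by (simp add: of_nat_diff)
      moreover have "real (card E - i) = real (card E) - i" using i by simp
      ultimately show ?thesis using i by (simp add: field_simps)
    next
      case False
      then show ?thesis using F i by (auto simp: field_simps)
    qed
  qed simp
  then show ?thesis by (simp add: perm_prob_avoid[OF assms])
qed

text \<open>Deleting \<open>x\<close> from a random permutation leaves a random permutation of the rest, and there are
  \<open>m\<close> admissible positions for \<open>x\<close>.\<close>

lemma perm_prob_remove_le:
  assumes "finite E" "x \<in> E" "x \<notin> J" "x \<notin> F"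
  shows "perm_prob E (\<lambda>xs. insert x J \<subseteq> set (take m xs) \<and> F \<inter> set (take l xs) = {}) \<le>
    m / card E * perm_prob (E - {x})
      (\<lambda>xs. J \<subseteq> set (take (m - 1) xs) \<and> F \<inter> set (take (l - 1) xs) = {})"
proof -
  define A where "A = {xs \<in> permutations_of_set E.
    insert x J \<subseteq> set (take m xs) \<and> F \<inter> set (take l xs) = {}}"
  define B where "B = {xs \<in> permutations_of_set (E - {x}).
    J \<subseteq> set (take (m - 1) xs) \<and> F \<inter> set (take (l - 1) xs) = {}}"
  have "A \<subseteq> (\<lambda>(i, ws). take i ws @ x # drop i ws) ` ({..<m} \<times> B)"
  proof
    fix xs assume xs: "xs \<in> A"
    then have "x \<in> set (take m xs)" by (auto simp: A_def)
    then obtain i where i: "i < m" "i < length xs" "xs ! i = x"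
      by (auto simp: in_set_conv_nth)
    define ys where "ys = take i xs"
    define zs where "zs = drop (Suc i) xs"
    have split: "xs = ys @ x # zs" and len: "length ys = i"
      using id_take_nth_drop[OF i(2)] i by (simp_all add: ys_def zs_def)
    have perm: "ys @ zs \<in> permutations_of_set (E - {x})"
      using xs by (auto simp: A_def permutations_of_set_def split)
    have "take m (ys @ x # zs) = ys @ x # take (m - 1 - i) zs"
      "take (m - 1) (ys @ zs) = ys @ take (m - 1 - i) zs"
      using i by (auto simp: len take_Cons' Suc_diff_Suc)
    then have J: "J \<subseteq> set (take (m - 1) (ys @ zs))"
      using xs assms(3) by (auto simp: A_def split)
    \<comment> \<open>Reading one position less covers both cases: if \<open>x\<close> stood among
      the first \<open>l\<close> entries, its removal shifts the later ones by one; otherwise the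
      prefix just gets shorter.\<close>
    have "set (take (l - 1) (ys @ zs)) \<subseteq> set (take l (ys @ x # zs))"
    proof (cases "i < l")
      case True
      then have "take l (ys @ x # zs) = ys @ x # take (l - 1 - i) zs"
        "take (l - 1) (ys @ zs) = ys @ take (l - 1 - i) zs"
        by (auto simp: len take_Cons' Suc_diff_Suc)
      then show ?thesis by auto
    next
      case False
      then show ?thesis by (simp add: len set_take_subset_set_take)
    qed
    then have "F \<inter> set (take (l - 1) (ys @ zs)) = {}"
      using xs by (auto simp: A_def split)
    with perm J have "ys @ zs \<in> B" by (simp add: B_def)
    moreover have "xs = (\<lambda>(i, ws). take i ws @ x # drop i ws) (i, ys @ zs)"
      by (simp add: split len)
    ultimately show "xs \<in> (\<lambda>(i, ws). take i ws @ x # drop i ws) ` ({..<m} \<times> B)"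
      using i(1) by blast
  qed
  moreover have "finite B" by (simp add: B_def)
  ultimately have "card A \<le> card ({..<m} \<times> B)"
    by (intro surj_card_le) auto
  then have "card A \<le> m * card B"
    unfolding card_cartesian_product card_lessThan .
  then have "real (card A) \<le> m * card B"
    by (metis of_nat_le_iff of_nat_mult)
  moreover have "fact (card E) = card E * (fact (card E - 1) :: real)"
    using assms by (intro fact_reduce) (auto simp: card_gt_0_iff)
  ultimately show ?thesis
    using assms unfolding perm_prob_def A_def[symmetric] B_def[symmetric]
    by (simp add: divide_right_mono)
qed

text \<open>Remove the elements of \<open>J\<close> one at a time: each costs a factor
  \<open>m / card E\<close> and at most one of the \<open>l\<close> rounds in which \<open>F\<close>
  is avoided. The ratios for the smaller ground set are dominated by those for \<open>E\<close>, so
  the result looks as if draws were independent. There are two cut-offs because edges will be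
  required by the upper time and avoided up to an earlier one.\<close>

lemma perm_prob_include_avoid_le:
  assumes "finite E" "J \<subseteq> E" "F \<subseteq> E" "J \<inter> F = {}" "l \<le> m" "m \<le> card E"
  shows "perm_prob E (\<lambda>xs. J \<subseteq> set (take m xs) \<and> F \<inter> set (take l xs) = {}) \<le>
    (m / card E) ^ card J * (1 - card F / card E) ^ (l - card J)"
proof -
  have "finite J" using assms finite_subset by blast
  then show ?thesis
    using assms
  proof (induction J arbitrary: E l m rule: finite_induct)
    case empty
    then show ?case using perm_prob_avoid_le[of E F l] by simp
  next
    case (insert x J)
    let ?N = "real (card E)"
    have E': "card (E - {x}) = card E - 1" using insert.prems by simp
    have pos: "card E > 0" using insert.prems by (auto simp: card_gt_0_iff)
    have FE: "F \<subseteq> E - {x}" using insert.prems by auto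
    have F: "card F \<le> card E - 1"
      using card_mono[OF _ FE] insert.prems by simp
    have "perm_prob E (\<lambda>xs. insert x J \<subseteq> set (take m xs) \<and> F \<inter> set (take l xs) = {}) \<le>
      m / ?N * perm_prob (E - {x})
      (\<lambda>xs. J \<subseteq> set (take (m - 1) xs) \<and> F \<inter> set (take (l - 1) xs) = {})"
      using insert by (intro perm_prob_remove_le) auto
    also have "\<dots> \<le> m / ?N * ((real (m - 1) / real (card E - 1)) ^ card J *
        (1 - card F / real (card E - 1)) ^ (l - 1 - card J))"
      unfolding E'[symmetric] using insert.prems insert.hyps FE
      by (intro mult_left_mono insert.IH) auto
    also have "\<dots> \<le> m / ?N * ((m / ?N) ^ card J * (1 - card F / ?N) ^ (l - 1 - card J))"
    proof (intro mult_left_mono mult_mono power_mono)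
      show "real (m - 1) / real (card E - 1) \<le> m / ?N"
      proof (cases "card E = 1 \<or> m = 0")
        case False
        then show ?thesis using insert.prems pos by (simp add: of_nat_diff field_simps)
      qed auto
      show "1 - card F / real (card E - 1) \<le> 1 - card F / ?N"
        using F pos by (cases "card E = 1") (auto simp: field_simps of_nat_diff)
      show *: "0 \<le> 1 - card F / real (card E - 1)"
        using F by (cases "card E = 1") (auto simp: divide_le_eq_1)
      then show "0 \<le> (1 - card F / real (card E - 1)) ^ (l - 1 - card J)"
        by (rule zero_le_power)
    qed simp_all
    also have "\<dots> = (m / ?N) ^ card (insert x J) * (1 - card F / ?N) ^ (l - card (insert x J))"
      using insert.hyps by (simp add: mult.assoc)
    finally show ?case .
  qed
qed

section \<open>Few hits in a fixed set of edges\<close>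

lemma binomial_le_power: "real (n choose k) \<le> real n ^ k"
proof (cases "k \<le> n")
  case True
  then show ?thesis using binomial_le_pow[of k n] by (metis of_nat_le_iff of_nat_power)
qed (simp add: binomial_eq_0)

text \<open>In the applications \<open>card W * x\<close> is of logarithmic order, so the crude step
  of using the power \<open>l\<close> for every size costs only a power of a logarithm.\<close>

lemma sum_power_card_subsets_le:
  fixes x :: real
  assumes "finite W" "0 \<le> x"
  shows "(\<Sum>I | I \<subseteq> W \<and> card I < l. x ^ card I) \<le> l * (1 + card W * x) ^ l"
proof -
  have eq: "{I. I \<subseteq> W \<and> card I < l} = (\<Union>i<l. {I. I \<subseteq> W \<and> card I = i})"
    by auto
  have "(\<Sum>I | I \<subseteq> W \<and> card I < l. x ^ card I) =
      (\<Sum>i<l. \<Sum>I | I \<subseteq> W \<and> card I = i. x ^ card I)"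
    unfolding eq using assms(1) by (intro sum.UNION_disjoint) (auto simp: finite_subset)
  also have "\<dots> = (\<Sum>i<l. (card W choose i) * x ^ i)"
    using n_subsets[OF assms(1)] by (intro sum.cong) auto
  also have "\<dots> \<le> (\<Sum>i<l. (1 + card W * x) ^ l)"
  proof (rule sum_mono)
    fix i assume i: "i \<in> {..<l}"
    have "real (card W choose i) \<le> real (card W) ^ i"
      by (rule binomial_le_power)
    then have "(card W choose i) * x ^ i \<le> (card W * x) ^ i"
      using assms by (simp add: power_mult_distrib mult_right_mono)
    also have "\<dots> \<le> (1 + card W * x) ^ i"
      using assms by (intro power_mono) auto
    also have "\<dots> \<le> (1 + card W * x) ^ l"
      using assms i by (intro power_increasing) auto
    finally show "(card W choose i) * x ^ i \<le> (1 + card W * x) ^ l" .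
  qed
  also have "\<dots> = l * (1 + card W * x) ^ l" by simp
  finally show ?thesis .
qed

text \<open>Expose the exact set \<open>I\<close> of hits in \<open>W\<close> outside
  \<open>J\<close> among the first \<open>r\<close> entries. For fixed \<open>I\<close> the event is
  an inclusion of \<open>J \<union> I\<close> by time \<open>m\<close> together with an avoidance of
  the rest of \<open>W\<close> up to time \<open>r\<close>; then sum over \<open>I\<close>. The set
  \<open>J\<close> is carried along so that low degree can be combined with the presence of given
  edges without an independence argument.\<close>

lemma perm_prob_few_le:
  assumes "finite E" "J \<subseteq> E" "W \<subseteq> E" "r \<le> m" "m \<le> card E"
    and large: "card J + l \<le> card W" "card J + l \<le> r"
  shows "perm_prob E (\<lambda>xs. J \<subseteq> set (take m xs) \<and> card (set (take r xs) \<inter> W) < l) \<le>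
    l * (1 + card W * (m / card E)) ^ l * (m / card E) ^ card J *
    exp (- (real (card W - card J - l) * real (r - card J - l) / card E))"
proof -
  define x where "x = real m / card E"
  define D where "D = exp (- (real (card W - card J - l) * real (r - card J - l) / card E))"
  define S where "S = {I. I \<subseteq> W - J \<and> card I < l}"
  have fW: "finite W" and fJ: "finite J" using assms finite_subset by blast+
  then have fS: "finite S" by (auto simp: S_def)
  have N: "card W \<le> card E" using assms card_mono by blast
  have "perm_prob E (\<lambda>xs. J \<subseteq> set (take m xs) \<and> card (set (take r xs) \<inter> W) < l) \<le>
      perm_prob E (\<lambda>xs. \<exists>I\<in>S. J \<union> I \<subseteq> set (take m xs) \<and> (W - J - I) \<inter> set (take r xs) = {})"
  proof (rule perm_prob_mono)
    fix xs assume xs: "J \<subseteq> set (take m xs) \<and> card (set (take r xs) \<inter> W) < l"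
    define I where "I = set (take r xs) \<inter> W - J"
    have "card I \<le> card (set (take r xs) \<inter> W)" unfolding I_def by (intro card_mono) auto
    then have "I \<in> S" using xs by (auto simp: S_def I_def)
    moreover have "set (take r xs) \<subseteq> set (take m xs)"
      using assms by (intro set_take_subset_set_take)
    then have "J \<union> I \<subseteq> set (take m xs)" using xs by (auto simp: I_def)
    moreover have "(W - J - I) \<inter> set (take r xs) = {}" by (auto simp: I_def)
    ultimately show "\<exists>I\<in>S. J \<union> I \<subseteq> set (take m xs) \<and> (W - J - I) \<inter> set (take r xs) = {}"
      by blast
  qed
  also have "\<dots> \<le> (\<Sum>I\<in>S. perm_prob E
      (\<lambda>xs. J \<union> I \<subseteq> set (take m xs) \<and> (W - J - I) \<inter> set (take r xs) = {}))"
    by (rule perm_prob_Bex[OF fS])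
  also have "\<dots> \<le> (\<Sum>I\<in>S. x ^ card J * D * x ^ card I)"
  proof (rule sum_mono)
    fix I assume I: "I \<in> S"
    then have fI: "finite I" using fW by (auto simp: S_def intro: finite_subset)
    define F where "F = W - J - I"
    have "card W - card J \<le> card (W - J)" using fJ by (intro diff_card_le_card_Diff)
    moreover have "card (W - J) - card I \<le> card F" unfolding F_def using fI by (intro diff_card_le_card_Diff)
    ultimately have F: "card W - card J - l \<le> card F" using I by (auto simp: S_def)
    have FE: "card F \<le> card E" using assms by (intro card_mono) (auto simp: F_def)
    have JI: "card (J \<union> I) = card J + card I"
      using I fJ fI by (intro card_Un_disjoint) (auto simp: S_def)
    have "perm_prob E (\<lambda>xs. J \<union> I \<subseteq> set (take m xs) \<and> F \<inter> set (take r xs) = {}) \<le>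
      x ^ card (J \<union> I) * (1 - card F / card E) ^ (r - card (J \<union> I))"
      unfolding x_def using I assms by (intro perm_prob_include_avoid_le) (auto simp: S_def F_def)
    \<comment> \<open>This is \<open>1 - t \<le> exp (- t)\<close>. Both the set to be avoided and
      the number of rounds have lost at most \<open>card J + l\<close>.\<close>
    moreover have "(1 - card F / card E) ^ (r - card (J \<union> I)) \<le> D"
    proof -
      have "(1 - card F / card E) ^ (r - card (J \<union> I)) \<le>
          exp (- (card F / card E)) ^ (r - card (J \<union> I))"
        using FE exp_ge_add_one_self[of "- (card F / card E)"]
        by (intro power_mono) (auto simp: divide_le_eq_1)
      also have "\<dots> = exp (- (card F * real (r - card (J \<union> I)) / card E))"
        by (simp add: exp_of_nat_mult[symmetric])
      also have "\<dots> \<le> D"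
        unfolding D_def exp_le_cancel_iff neg_le_iff_le
        using F I by (intro divide_right_mono mult_mono) (auto simp: JI S_def)
      finally show ?thesis .
    qed
    moreover have "0 \<le> x ^ card (J \<union> I)" by (simp add: x_def)
    ultimately have "perm_prob E (\<lambda>xs. J \<union> I \<subseteq> set (take m xs) \<and> F \<inter> set (take r xs) = {}) \<le>
        x ^ card (J \<union> I) * D"
      using mult_left_mono order_trans by meson
    then show "perm_prob E (\<lambda>xs. J \<union> I \<subseteq> set (take m xs) \<and> (W - J - I) \<inter> set (take r xs) = {})
        \<le> x ^ card J * D * x ^ card I"
      unfolding F_def JI power_add by (simp only: mult_ac)
  qed
  also have "\<dots> = x ^ card J * D * (\<Sum>I\<in>S. x ^ card I)"
    by (simp add: sum_distrib_left)
  also have "\<dots> \<le> x ^ card J * D * (l * (1 + card W * x) ^ l)"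
  proof (rule mult_left_mono)
    have "(\<Sum>I\<in>S. x ^ card I) \<le> l * (1 + card (W - J) * x) ^ l"
      unfolding S_def
      by (rule sum_power_card_subsets_le) (use fW in \<open>auto simp: x_def\<close>)
    also have "\<dots> \<le> l * (1 + card W * x) ^ l"
      using fW by (intro mult_left_mono power_mono add_left_mono mult_right_mono of_nat_mono card_mono)
        (auto simp: x_def)
    finally show "(\<Sum>I\<in>S. x ^ card I) \<le> l * (1 + card W * x) ^ l" .
  qed (simp add: x_def D_def)
  finally show ?thesis
    by (simp only: x_def D_def mult_ac)
qed

section \<open>A deterministic criterion for connectivity\<close>

lemma same_component_closed:
  assumes "same_component E u w" "e \<in> E" "w \<in> e" "x \<in> e"
  shows "same_component E u x"
proof (cases "u = w")
  case True
  then show ?thesis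
    using assms unfolding same_component_def by (intro disjI2 exI[of _ "[e]"]) auto
next
  case False
  then obtain es where "es \<noteq> []" "set es \<subseteq> E" "u \<in> hd es" "w \<in> last es"
    "successively (\<lambda>e f. e \<inter> f \<noteq> {}) es"
    using assms(1) unfolding same_component_def by blast
  then show ?thesis
    using assms unfolding same_component_def
    by (intro disjI2 exI[of _ "es @ [e]"]) (auto simp: successively_append_iff)
qed

text \<open>The vertices joined to a fixed one form a set that no edge leaves, so it suffices to
  rule out such sets. Sparsity and expansion both speak about edges leaving a set.\<close>

lemma hg_connectedI_cut:
  assumes "\<And>A. A \<subseteq> V \<Longrightarrow> A \<noteq> {} \<Longrightarrow> A \<noteq> V \<Longrightarrow> \<exists>e\<in>E. e \<inter> A \<noteq> {} \<and> e \<inter> (V - A) \<noteq> {}"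
  shows "hg_connected V E"
proof (rule ccontr)
  assume "\<not> hg_connected V E"
  then obtain u v where uv: "u \<in> V" "v \<in> V" "\<not> same_component E u v"
    by (auto simp: hg_connected_def)
  define A where "A = {w \<in> V. same_component E u w}"
  have "u \<in> A" "v \<notin> A" using uv by (auto simp: A_def same_component_def)
  then obtain e where "e \<in> E" "e \<inter> A \<noteq> {}" "e \<inter> (V - A) \<noteq> {}"
    using assms[of A] uv by (auto simp: A_def)
  then show False
    using same_component_closed[of E u _ e] by (fastforce simp: A_def)
qed

lemma hg_min_degree_ge_iff:
  assumes "finite V" "V \<noteq> {}"
  shows "k \<le> hg_min_degree V E \<longleftrightarrow> (\<forall>v\<in>V. k \<le> hg_degree E v)"
  using assms by (auto simp: hg_min_degree_def)

lemma hg_degree_mono: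
  assumes "finite F" "E \<subseteq> F"
  shows "hg_degree E v \<le> hg_degree F v"
  unfolding hg_degree_def using assms by (intro card_mono) auto

text \<open>On each of the at most \<open>k - 1\<close> edges at a vertex of small degree choose one
  further vertex. Deleting the chosen vertices destroys all these edges and isolates the
  vertex.\<close>

lemma k_connected_imp_min_degree:
  assumes V: "finite V" and E: "finite E" "\<And>e. e \<in> E \<Longrightarrow> e \<subseteq> V \<and> 2 \<le> card e"
    and conn: "k_connected k V E" and k: "1 \<le> k"
  shows "k \<le> hg_min_degree V E"
proof -
  have kV: "k < card V" using conn by (simp add: k_connected_def)
  have "k \<le> hg_degree E v" if v: "v \<in> V" for v
  proof (rule ccontr)
    assume "\<not> k \<le> hg_degree E v"
    then have deg: "card {e \<in> E. v \<in> e} \<le> k - 1" by (simp add: hg_degree_def)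
    have "\<exists>x\<in>e. x \<noteq> v" if "e \<in> E" for e
    proof (rule ccontr)
      assume "\<not> (\<exists>x\<in>e. x \<noteq> v)"
      then have "e \<subseteq> {v}" by auto
      then have "card e \<le> 1" using card_mono[of "{v}" e] by simp
      then show False using E(2)[OF that] by simp
    qed
    then obtain g where g: "\<And>e. e \<in> E \<Longrightarrow> g e \<in> e \<and> g e \<noteq> v" by metis
    define S0 where "S0 = g ` {e \<in> E. v \<in> e}"
    have S0: "card S0 \<le> k - 1" "S0 \<subseteq> V - {v}"
      using deg card_image_le[of "{e \<in> E. v \<in> e}" g] E g by (auto simp: S0_def)
    \<comment> \<open>\<open>k_connected\<close> tests only sets of exactly \<open>k - 1\<close>
      vertices, so the chosen ones are padded by vertices other than \<open>v\<close>. Together with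
      \<open>v\<close> these are at most \<open>k < card V\<close> vertices, so another vertex
      survives.\<close>
    obtain S where S: "S0 \<subseteq> S" "S \<subseteq> V - {v}" "card S = k - 1"
      using exists_subset_between[of S0 "k - 1" "V - {v}"] S0 kV V v
      by (fastforce simp: card_Diff_singleton)
    have "card (insert v S) \<le> k"
      using S(3) k card_insert_le_m1[of k S v] by (cases "finite S") auto
    then have "\<not> V \<subseteq> insert v S"
    proof -
      have "finite (insert v S)" using S(2) V finite_subset by fast
      then show ?thesis
        using \<open>card (insert v S) \<le> k\<close> kV card_mono[of "insert v S" V] by linarith
    qed
    then obtain w where w: "w \<in> V - S" "w \<noteq> v" by auto
    have "hg_connected (V - S) {e \<in> E. e \<inter> S = {}}"
      using conn S by (auto simp: k_connected_def)
    then have "same_component {e \<in> E. e \<inter> S = {}} v w"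
      using w v S by (auto simp: hg_connected_def)
    then obtain es where "es \<noteq> []" "set es \<subseteq> {e \<in> E. e \<inter> S = {}}" "v \<in> hd es"
      using w by (auto simp: same_component_def)
    then have "hd es \<in> E" "hd es \<inter> S = {}" "v \<in> hd es"
      using hd_in_set by blast+
    moreover from this have "g (hd es) \<in> S" using S(1) by (auto simp: S0_def)
    ultimately show False using g by blast
  qed
  moreover have "V \<noteq> {}" using kV by auto
  ultimately show ?thesis using V by (simp add: hg_min_degree_ge_iff)
qed

lemma card_edges_hitting_le:
  assumes "finite E" "finite S" "\<And>s. s \<in> S \<Longrightarrow> card {e \<in> E. v \<in> e \<and> s \<in> e} \<le> c"
  shows "card {e \<in> E. v \<in> e \<and> e \<inter> S \<noteq> {}} \<le> c * card S"
proof -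
  have *: "{e \<in> E. v \<in> e \<and> e \<inter> S \<noteq> {}} = (\<Union>s\<in>S. {e \<in> E. v \<in> e \<and> s \<in> e})"
    by auto
  have "card {e \<in> E. v \<in> e \<and> e \<inter> S \<noteq> {}} \<le> (\<Sum>s\<in>S. card {e \<in> E. v \<in> e \<and> s \<in> e})"
    unfolding * by (rule card_UN_le[OF assms(2)])
  also have "\<dots> \<le> card S * c"
    using assms(3) by (intro sum_bounded_above[where 'a = nat, simplified]) auto
  finally show ?thesis by (simp add: mult.commute)
qed

text \<open>\<open>E0\<close>, \<open>E\<close> and \<open>E1\<close> stand for the edges at the
  lower time, at a time in between and at the upper time. Upper bounds are assumed for
  \<open>E1\<close> and existence for \<open>E0\<close>, so both apply to \<open>E\<close>. In
  \<open>low_far\<close> the edges \<open>e\<close> and \<open>f\<close> may coincide; hence it also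
  forbids an edge through two low vertices.\<close>

lemma k_connected_between:
  fixes x :: real
  assumes V: "finite V" "k < card V" and E: "E0 \<subseteq> E" "E \<subseteq> E1" "\<And>e. e \<in> E1 \<Longrightarrow> e \<subseteq> V \<and> card e = d"
    and dk: "3 \<le> d" "1 \<le> k" and L: "3 * d + 2 * k \<le> L"
    and degE: "\<And>v. v \<in> V \<Longrightarrow> k \<le> hg_degree E v"
    and codeg: "\<And>u w. u \<in> V \<Longrightarrow> w \<in> V \<Longrightarrow> u \<noteq> w \<Longrightarrow> card {e \<in> E1. u \<in> e \<and> w \<in> e} \<le> 2"
    and low_codeg: "\<And>u w. u \<in> V \<Longrightarrow> w \<in> V \<Longrightarrow> u \<noteq> w \<Longrightarrow> hg_degree E0 u < L \<Longrightarrow>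
      card {e \<in> E1. u \<in> e \<and> w \<in> e} \<le> 1"
    and low_far: "\<And>u v e f. u \<in> V \<Longrightarrow> v \<in> V \<Longrightarrow> u \<noteq> v \<Longrightarrow> hg_degree E0 u < L \<Longrightarrow>
      hg_degree E0 v < L \<Longrightarrow> e \<in> E1 \<Longrightarrow> f \<in> E1 \<Longrightarrow> u \<in> e \<Longrightarrow> v \<in> f \<Longrightarrow> e \<inter> f = {}"
    and sparse: "\<And>A. A \<subseteq> V \<Longrightarrow> A \<noteq> {} \<Longrightarrow> card A \<le> x \<Longrightarrow> card {e \<in> E1. e \<subseteq> A} < 2 * card A"
    and expand: "\<And>A S. S \<subseteq> V \<Longrightarrow> card S = k - 1 \<Longrightarrow> A \<subseteq> V - S \<Longrightarrow> x < card A \<Longrightarrow>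
      2 * card A \<le> card (V - S) \<Longrightarrow> \<exists>e\<in>E0. e \<inter> S = {} \<and> e \<inter> A \<noteq> {} \<and> \<not> e \<subseteq> A"
  shows "k_connected k V E"
  unfolding k_connected_def
proof (intro conjI allI impI hg_connectedI_cut)
  fix S A0 assume S: "S \<subseteq> V" "card S = k - 1"
    and A0: "A0 \<subseteq> V - S" "A0 \<noteq> {}" "A0 \<noteq> V - S"
  have "E1 \<subseteq> Pow V" using E(3) by blast
  then have fE1: "finite E1" using V(1) finite_subset by blast
  have fE: "finite E" "finite E0" using fE1 E by (auto intro: finite_subset)
  have fS: "finite S" using S V finite_subset by blast
  have eV: "e \<subseteq> V" if "e \<in> E" for e using that E by blast

  have deg_hit: "card {e \<in> E. v \<in> e \<and> e \<inter> S \<noteq> {}} \<le> 2 * (k - 1)" if "v \<in> V - S" for v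
  proof -
    have "card {e \<in> E. v \<in> e \<and> s \<in> e} \<le> 2" if "s \<in> S" for s
    proof -
      have "card {e \<in> E. v \<in> e \<and> s \<in> e} \<le> card {e \<in> E1. v \<in> e \<and> s \<in> e}"
        using E fE1 by (intro card_mono) auto
      then show ?thesis using codeg[of v s] that \<open>v \<in> V - S\<close> S by fastforce
    qed
    from card_edges_hitting_le[OF fE(1) fS this] show ?thesis by (simp add: S(2))
  qed
  \<comment> \<open>Deleting \<open>S\<close> destroys at most \<open>k - 1\<close> edges at a low
    vertex, fewer than its degree, and at most \<open>2 * (k - 1)\<close> edges at any other vertex,
    fewer than \<open>L\<close>.\<close>
  have nonisolated: "\<exists>e\<in>E. v \<in> e \<and> e \<inter> S = {}" if v: "v \<in> V - S" for v
  proof (rule ccontr)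
    assume "\<not> (\<exists>e\<in>E. v \<in> e \<and> e \<inter> S = {})"
    then have all: "{e \<in> E. v \<in> e} = {e \<in> E. v \<in> e \<and> e \<inter> S \<noteq> {}}" by auto
    show False
    proof (cases "hg_degree E0 v < L")
      case True
      have "card {e \<in> E. v \<in> e \<and> s \<in> e} \<le> 1" if "s \<in> S" for s
      proof -
        have "card {e \<in> E. v \<in> e \<and> s \<in> e} \<le> card {e \<in> E1. v \<in> e \<and> s \<in> e}"
          using E fE1 by (intro card_mono) auto
        then show ?thesis using low_codeg[of v s] that v S True by fastforce
      qed
      from card_edges_hitting_le[OF fE(1) fS this] have "card {e \<in> E. v \<in> e} \<le> 1 * (k - 1)"
        unfolding all S(2) .
      then show False using degE[of v] v dk by (simp add: hg_degree_def)
    next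
      case False
      moreover have "hg_degree E0 v \<le> hg_degree E v" by (rule hg_degree_mono[OF fE(1) E(1)])
      moreover have "hg_degree E v \<le> 2 * (k - 1)" using deg_hit[OF v] all by (simp add: hg_degree_def)
      ultimately show False using L dk by linarith
    qed
  qed

  have cut: "\<exists>e\<in>E. e \<inter> S = {} \<and> e \<inter> A \<noteq> {} \<and> \<not> e \<subseteq> A"
    if A: "A \<subseteq> V - S" "A \<noteq> {}" "2 * card A \<le> card (V - S)" for A
  proof (cases "x < card A")
    case True
    then show ?thesis using expand[OF S A(1) _ A(3)] E by blast
  next
    case False
    show ?thesis
    proof (rule ccontr)
      assume "\<not> ?thesis"
      then have inside: "e \<subseteq> A" if "e \<in> E" "e \<inter> S = {}" "e \<inter> A \<noteq> {}" for e
        using that by blast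
      define Low where "Low = {v \<in> A. hg_degree E0 v < L}"
      define High where "High = A - Low"
      have fA: "finite A" using A(1) V finite_subset by blast
      then have fin: "finite Low" "finite High" by (auto simp: Low_def High_def)
      have "\<exists>e. e \<in> E \<and> v \<in> e \<and> e \<subseteq> A" if "v \<in> A" for v
        using nonisolated[of v] inside that A(1) by blast
      then obtain f where f: "\<And>v. v \<in> A \<Longrightarrow> f v \<in> E \<and> v \<in> f v \<and> f v \<subseteq> A" by metis
      have f1: "f v \<in> E1" "finite (f v)" "card (f v) = d" if "v \<in> A" for v
        using f[OF that] E fA by (auto intro: finite_subset)
      have inV: "v \<in> V" if "v \<in> A" for v using that A(1) by blast
      have sub: "f v - {v} \<subseteq> High" if v: "v \<in> Low" for v
      proof
        fix w assume w: "w \<in> f v - {v}"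
        have vA: "v \<in> A" using v by (simp add: Low_def)
        then have wA: "w \<in> A" using f w by blast
        have "w \<notin> Low"
          using low_far[of v w "f v" "f v"] f1(1)[OF vA] f[OF vA] w v wA vA inV
          by (auto simp: Low_def)
        then show "w \<in> High" using wA by (simp add: High_def)
      qed
      have disj: "(f u - {u}) \<inter> (f v - {v}) = {}" if "u \<in> Low" "v \<in> Low" "u \<noteq> v" for u v
        using low_far[of u v "f u" "f v"] f1(1) f that inV by (auto simp: Low_def)
      \<comment> \<open>The sets \<open>f v - {v}\<close> are disjoint because edges at different
        low vertices do not meet; \<open>d - 1 \<ge> 2\<close> then gives the factor 2.\<close>
      have "(d - 1) * card Low = (\<Sum>v\<in>Low. card (f v - {v}))"
        using f f1 by (simp add: Low_def mult.commute)
      also have "\<dots> = card (\<Union>v\<in>Low. f v - {v})"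
        using fin f1 disj by (intro card_UN_disjoint[symmetric]) (auto simp: Low_def)
      also have "\<dots> \<le> card High"
        using sub fin by (intro card_mono) auto
      finally have "2 * card Low \<le> card High"
        using dk(1) mult_le_mono1[of 2 "d - 1" "card Low"] by linarith
      moreover have "card A = card Low + card High"
        using fA by (subst card_Un_disjoint[symmetric]) (auto simp: High_def Low_def intro!: arg_cong[where f = card])
      ultimately have AH: "2 * card A \<le> 3 * card High" by simp
      define EA where "EA = {e \<in> E1. e \<subseteq> A}"
      have fEA: "finite EA" using fE1 by (simp add: EA_def)
      \<comment> \<open>Origin of \<open>L\<close>: at most \<open>2 * (k - 1)\<close> of the
        \<open>L\<close> edges at a high vertex meet \<open>S\<close>. The others cannot leave
        \<open>A\<close>, and at least \<open>3 * d\<close> of them remain.\<close>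
      have high: "3 * d \<le> card {e \<in> EA. u \<in> e}" if u: "u \<in> High" for u
      proof -
        have uA: "u \<in> A" and "L \<le> hg_degree E0 u" using u by (auto simp: High_def Low_def)
        then have "L \<le> card {e \<in> E0. u \<in> e}" by (simp add: hg_degree_def)
        also have "\<dots> \<le> card ({e \<in> EA. u \<in> e} \<union> {e \<in> E. u \<in> e \<and> e \<inter> S \<noteq> {}})"
        proof (rule card_mono)
          show "finite ({e \<in> EA. u \<in> e} \<union> {e \<in> E. u \<in> e \<and> e \<inter> S \<noteq> {}})"
            using fEA fE by simp
          show "{e \<in> E0. u \<in> e} \<subseteq> {e \<in> EA. u \<in> e} \<union> {e \<in> E. u \<in> e \<and> e \<inter> S \<noteq> {}}"
            using inside uA E(1,2) by (auto simp: EA_def)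
        qed
        also have "\<dots> \<le> card {e \<in> EA. u \<in> e} + card {e \<in> E. u \<in> e \<and> e \<inter> S \<noteq> {}}"
          by (rule card_Un_le)
        also have "\<dots> \<le> card {e \<in> EA. u \<in> e} + 2 * (k - 1)"
          using deg_hit[of u] uA A(1) by auto
        finally show ?thesis using L by linarith
      qed
      \<comment> \<open>Count incidences between high vertices and edges inside \<open>A\<close>. An
        edge is counted at most \<open>d\<close> times, so
        \<open>3 * card High \<le> card EA\<close>; with
        \<open>2 * card A \<le> 3 * card High\<close> there are at least \<open>2 * card A\<close>
        edges inside \<open>A\<close>, against \<open>sparse\<close>.\<close>
      have "card High * (3 * d) \<le> (\<Sum>u\<in>High. card {e \<in> EA. u \<in> e})"
        using high by (intro sum_bounded_below[where 'a = nat, simplified]) auto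
      also have "\<dots> = (\<Sum>e\<in>EA. card {u \<in> High. u \<in> e})"
        using sum.swap_restrict[OF fin(2) fEA, of "\<lambda>_ _. 1::nat" "\<lambda>u e. u \<in> e"] by simp
      also have "\<dots> \<le> (\<Sum>e\<in>EA. d)"
      proof (rule sum_mono)
        fix e assume "e \<in> EA"
        then have "finite e" "card e = d" using E fA by (auto simp: EA_def intro: finite_subset)
        then show "card {u \<in> High. u \<in> e} \<le> d" using card_mono[of e "{u \<in> High. u \<in> e}"] by auto
      qed
      also have "\<dots> = card EA * d" by simp
      finally have "3 * card High \<le> card EA"
        using dk(1) by (simp add: mult.assoc[symmetric] mult.commute[of 3])
      moreover have "card EA < 2 * card A"
        unfolding EA_def using sparse[of A] A False V(1) by auto
      ultimately show False using AH by linarith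
    qed
  qed
  \<comment> \<open>An edge avoiding \<open>S\<close> crosses between \<open>A0\<close> and its
    complement in \<open>V - S\<close> symmetrically, so the smaller of the two sides may be
    used.\<close>
  show "\<exists>e\<in>{e \<in> E. e \<inter> S = {}}. e \<inter> A0 \<noteq> {} \<and> e \<inter> (V - S - A0) \<noteq> {}"
  proof (cases "2 * card A0 \<le> card (V - S)")
    case True
    then obtain e where "e \<in> E" "e \<inter> S = {}" "e \<inter> A0 \<noteq> {}" "\<not> e \<subseteq> A0"
      using cut[OF A0(1,2)] by blast
    then show ?thesis using eV by blast
  next
    case False
    have "card (V - S - A0) = card (V - S) - card A0"
      using A0 V by (intro card_Diff_subset) (auto intro: finite_subset)
    then have "2 * card (V - S - A0) \<le> card (V - S)" using False by linarith
    then obtain e where e: "e \<in> E" "e \<inter> S = {}" "e \<inter> (V - S - A0) \<noteq> {}" "\<not> e \<subseteq> V - S - A0"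
      using cut[of "V - S - A0"] A0 by blast
    then show ?thesis using eV[OF e(1)] by blast
  qed
qed (use V in auto)

section \<open>Vertices of low degree\<close>

lemma card_all_edges_containing:
  assumes "T \<subseteq> {1..n}" "card T \<le> d"
  shows "card {e \<in> all_edges d n. T \<subseteq> e} = (n - card T) choose (d - card T)"
proof -
  have fT: "finite T" using assms finite_subset by blast
  have "bij_betw (\<lambda>X. X \<union> T) {X. X \<subseteq> {1..n} - T \<and> card X = d - card T} {e \<in> all_edges d n. T \<subseteq> e}"
  proof (rule bij_betw_byWitness[where f' = "\<lambda>e. e - T"])
    show "(\<lambda>X. X \<union> T) ` {X. X \<subseteq> {1..n} - T \<and> card X = d - card T} \<subseteq> {e \<in> all_edges d n. T \<subseteq> e}"
    proof clarify
      fix X assume X: "X \<subseteq> {1..n} - T" "card X = d - card T"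
      have "card (X \<union> T) = card X + card T"
        using X fT by (intro card_Un_disjoint) (auto intro: finite_subset)
      then show "X \<union> T \<in> all_edges d n \<and> T \<subseteq> X \<union> T"
        using X assms by (auto simp: all_edges_def)
    qed
    show "(\<lambda>e. e - T) ` {e \<in> all_edges d n. T \<subseteq> e} \<subseteq> {X. X \<subseteq> {1..n} - T \<and> card X = d - card T}"
      using fT by (auto simp: all_edges_def card_Diff_subset)
  qed auto
  then have "card {e \<in> all_edges d n. T \<subseteq> e} = card {X. X \<subseteq> {1..n} - T \<and> card X = d - card T}"
    by (simp add: bij_betw_same_card)
  also have "\<dots> = card ({1..n} - T) choose (d - card T)"
    by (intro n_subsets) simp
  finally show ?thesis using assms fT by (simp add: card_Diff_subset)
qed

text \<open>Taken among all possible edges, so it does not depend on the trajectory: the degree of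
  \<open>v\<close> at time \<open>m\<close> is the number of hits of this fixed set among the first
  \<open>m\<close> entries.\<close>

definition star :: "nat \<Rightarrow> nat \<Rightarrow> nat \<Rightarrow> nat set set" where
  "star d n v = {e \<in> all_edges d n. v \<in> e}"

lemma finite_star [simp]: "finite (star d n v)"
  by (simp add: star_def)

lemma card_star:
  assumes "v \<in> {1..n}" "1 \<le> d"
  shows "card (star d n v) = (n - 1) choose (d - 1)"
  using card_all_edges_containing[of "{v}" n d] assms by (simp add: star_def)

lemma card_star_Int:
  assumes "u \<in> {1..n}" "v \<in> {1..n}" "u \<noteq> v" "2 \<le> d"
  shows "card (star d n u \<inter> star d n v) = (n - 2) choose (d - 2)"
proof -
  have "star d n u \<inter> star d n v = {e \<in> all_edges d n. {u, v} \<subseteq> e}"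
    by (auto simp: star_def)
  then show ?thesis
    using card_all_edges_containing[of "{u, v}" n d] assms by (simp add: card_insert_if numeral_2_eq_2)
qed

lemma card_star_Int_le:
  assumes "u \<in> {1..n}" "v \<in> {1..n}" "u \<noteq> v" "2 \<le> d"
  shows "real (card (star d n u \<inter> star d n v)) \<le> real n ^ (d - 2)"
proof -
  have "real ((n - 2) choose (d - 2)) \<le> real (n - 2) ^ (d - 2)"
    by (rule binomial_le_power)
  also have "\<dots> \<le> real n ^ (d - 2)"
    by (intro power_mono) auto
  finally show ?thesis by (simp only: card_star_Int[OF assms])
qed

lemma card_star_Un:
  assumes "u \<in> {1..n}" "v \<in> {1..n}" "u \<noteq> v" "2 \<le> d"
  shows "card (star d n u \<union> star d n v) + ((n - 2) choose (d - 2)) = 2 * ((n - 1) choose (d - 1))"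
  using card_Un_Int[of "star d n u" "star d n v"] assms card_star[of u n d] card_star[of v n d]
    card_star_Int[OF assms] by simp

lemma hg_degree_eq_card_Int_star:
  assumes "E \<subseteq> all_edges d n"
  shows "hg_degree E v = card (E \<inter> star d n v)"
proof -
  have "{e \<in> E. v \<in> e} = E \<inter> star d n v" using assms by (auto simp: star_def)
  then show ?thesis by (simp add: hg_degree_def)
qed

lemma set_take_subset_permutation:
  "xs \<in> permutations_of_set E \<Longrightarrow> set (take m xs) \<subseteq> E"
  using set_take_subset[of m xs] by (auto simp: permutations_of_set_def)

text \<open>Both sides count incidences between vertices and possible edges. Hence a star is the
  fraction d / n of all edges, the source of the factor \<open>d\<close> in the exponents
  below.\<close>

lemma degree_product:
  assumes "1 \<le> d" "1 \<le> n"
  shows "real n * real ((n - 1) choose (d - 1)) = real d * real (n choose d)"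
proof -
  have "d * (n choose d) = n * ((n - 1) choose (d - 1))"
    using binomial_absorption[of "d - 1" n] assms by simp
  then have "real (d * (n choose d)) = real (n * ((n - 1) choose (d - 1)))"
    by (rule arg_cong)
  then show ?thesis by simp
qed

text \<open>The process is compared at two deterministic times. The factor \<open>3/4\<close> is any constant
  strictly between \<open>1/2\<close> and \<open>1\<close>: below \<open>1\<close> there are still isolated vertices, and above \<open>1/2\<close>
  vertices of bounded degree are pairwise far apart.\<close>

definition m_lo :: "nat \<Rightarrow> nat \<Rightarrow> nat" where
  "m_lo d n = nat \<lfloor>3/4 * (real n / real d) * ln (real n)\<rfloor>"

text \<open>The mean degree at this time is about 2 d ln n, so a single vertex has bounded degree
  with probability n^(-2 d) up to logarithms. Any coefficient above 1 / d would survive the union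
  bound over the vertices; the value 2 avoids a dependence on \<open>d\<close>.\<close>

definition m_hi :: "nat \<Rightarrow> nat" where
  "m_hi n = nat \<lfloor>2 * real n * ln (real n)\<rfloor>"

lemma m_lo_le: "1 \<le> n \<Longrightarrow> real (m_lo d n) \<le> 3/4 * (real n / real d) * ln (real n)"
  unfolding m_lo_def by (intro of_nat_floor) auto

lemma m_lo_ge: "real (m_lo d n) \<ge> 3/4 * (real n / real d) * ln (real n) - 1"
  unfolding m_lo_def by linarith

lemma m_hi_le: "1 \<le> n \<Longrightarrow> real (m_hi n) \<le> 2 * real n * ln (real n)"
  unfolding m_hi_def by (intro of_nat_floor) auto

lemma m_hi_ge: "real (m_hi n) \<ge> 2 * real n * ln (real n) - 1"
  unfolding m_hi_def by linarith

lemma m_lo_le_m_hi: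
  assumes "1 \<le> d" "1 \<le> n"
  shows "m_lo d n \<le> m_hi n"
proof -
  have "1 / real d \<le> 1" using assms by simp
  then have "3/4 * (1 / real d) \<le> 2" by linarith
  then have "3/4 * (1 / real d) * (real n * ln (real n)) \<le> 2 * (real n * ln (real n))"
    using assms by (intro mult_right_mono) auto
  then show ?thesis
    unfolding m_lo_def m_hi_def by (intro nat_mono floor_mono) (simp add: mult_ac)
qed

lemma filterlim_m_lo:
  assumes "1 \<le> d"
  shows "filterlim (m_lo d) at_top sequentially"
  unfolding m_lo_def using assms by real_asymp

lemma filterlim_m_hi: "filterlim m_hi at_top sequentially"
  unfolding m_hi_def by real_asymp

text \<open>The fraction of all possible edges present at the upper time. In the union bounds it
  takes the role of the edge probability in the binomial model.\<close>

definition dens :: "nat \<Rightarrow> nat \<Rightarrow> real" where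
  "dens d n = real (m_hi n) / real (n choose d)"

lemma dens_nonneg: "0 \<le> dens d n"
  by (simp add: dens_def)

text \<open>Follows from \<open>(n / d) ^ d \<le> n choose d\<close>. The left side is the order of
  the mean degree at the upper time, so this is where all later powers of ln n come from.\<close>

lemma dens_le:
  assumes "1 \<le> d" "d \<le> n"
  shows "real n ^ (d - 1) * dens d n \<le> 2 * real d ^ d * ln (real n)"
proof -
  have N: "(real n / real d) ^ d \<le> real (n choose d)"
    using binomial_ge_n_over_k_pow_k[OF assms(2), where 'a = real] by simp
  have pos: "0 < (real n / real d) ^ d" using assms by auto
  have "dens d n \<le> 2 * real n * ln (real n) / (real n / real d) ^ d"
    unfolding dens_def using assms by (intro frac_le m_hi_le N pos) auto
  then have "real n ^ (d - 1) * dens d n \<le>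
      real n ^ (d - 1) * (2 * real n * ln (real n) / (real n / real d) ^ d)"
    by (intro mult_left_mono) auto
  also have "\<dots> = 2 * real d ^ d * ln (real n) * (real n ^ (d - 1) * real n / real n ^ d)"
    using assms by (simp add: power_divide)
  also have "real n ^ (d - 1) * real n = real n ^ d"
    using assms by (metis Suc_diff_1 less_eq_Suc_le One_nat_def power_Suc2)
  finally show ?thesis using assms by simp
qed

lemma dens_le':
  assumes "2 \<le> d" "d \<le> n"
  shows "dens d n \<le> 2 * real d ^ d * ln (real n) / real n"
proof -
  have "real n * dens d n \<le> real n ^ (d - 1) * dens d n"
    using assms by (intro mult_right_mono dens_nonneg) (simp add: self_le_power)
  also have "\<dots> \<le> 2 * real d ^ d * ln (real n)"
    using assms by (intro dens_le) auto
  finally show ?thesis using assms by (simp add: field_simps)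
qed

lemma dens_tendsto_0:
  assumes "2 \<le> d"
  shows "dens d \<longlonglongrightarrow> 0"
proof (rule tendsto_sandwich[OF _ _ tendsto_const])
  show "(\<lambda>n. 2 * real d ^ d * ln (real n) / real n) \<longlonglongrightarrow> 0"
    by real_asymp
  show "\<forall>\<^sub>F n in sequentially. dens d n \<le> 2 * real d ^ d * ln (real n) / real n"
    using eventually_ge_at_top[of d] by eventually_elim (rule dens_le'[OF assms])
qed (auto simp: dens_nonneg)

text \<open>The bounds for permutations need a prefix no longer than the ground set, and the upper
  time has to occur in the process.\<close>

lemma eventually_m_hi_le:
  assumes "2 \<le> d"
  shows "\<forall>\<^sub>F n in sequentially. m_hi n \<le> n choose d"
proof -
  have "\<forall>\<^sub>F n in sequentially. dens d n < 1"
    using dens_tendsto_0[OF assms] by (rule order_tendstoD) simp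
  then show ?thesis
    using eventually_ge_at_top[of d]
  proof eventually_elim
    case (elim n)
    then have "0 < n choose d" by simp
    then show ?case using elim by (simp add: dens_def divide_less_eq)
  qed
qed

section \<open>Probability of bounded degree, uniformly in vertices and required edges\<close>

lemma filterlim_star_degree:
  assumes "2 \<le> d"
  shows "filterlim (\<lambda>n. real ((n - 1) choose (d - 1))) at_top sequentially"
proof (rule filterlim_at_top_mono)
  show "filterlim (\<lambda>n. (real n - 1) / real (d - 1)) at_top sequentially"
    using assms by real_asymp
  show "\<forall>\<^sub>F n in sequentially. (real n - 1) / real (d - 1) \<le> real ((n - 1) choose (d - 1))"
    using eventually_ge_at_top[of d]
  proof eventually_elim
    case (elim n)
    have "(real n - 1) / real (d - 1) = real (n - 1) / real (d - 1)"
      using elim assms by (simp add: of_nat_diff)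
    also have "\<dots> \<le> (real (n - 1) / real (d - 1)) ^ (d - 1)"
      using elim assms by (intro self_le_power) auto
    also have "\<dots> \<le> real ((n - 1) choose (d - 1))"
      using elim by (intro binomial_ge_n_over_k_pow_k) auto
    finally show ?case .
  qed
qed

text \<open>\<open>W\<close> will be one star or the union of two, which explains the size
  condition. The quantifiers over \<open>J\<close> and \<open>W\<close> stand inside the eventuality
  because a union bound needs one threshold for all of them. In \<open>K\<close>, the term
  \<open>4 * d\<close> comes from the mean number of hits, at most 4 d ln n, and
  \<open>exp 1\<close> pays for shortening both factors of the exponent by
  \<open>j + l\<close>.\<close>

lemma eventually_few_le:
  fixes d l j :: nat
  assumes d: "2 \<le> d" and r: "filterlim r at_top sequentially"
    and r_le: "\<forall>\<^sub>F n in sequentially. r n \<le> m_hi n"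
  defines "K \<equiv> real l * (4 * real d + 1) ^ l * exp 1"
  shows "\<forall>\<^sub>F n in sequentially. \<forall>J W. J \<subseteq> all_edges d n \<longrightarrow> card J = j \<longrightarrow> W \<subseteq> all_edges d n \<longrightarrow>
    (n - 1) choose (d - 1) \<le> card W \<longrightarrow> card W \<le> 2 * ((n - 1) choose (d - 1)) \<longrightarrow>
    perm_prob (all_edges d n)
      (\<lambda>xs. J \<subseteq> set (take (m_hi n) xs) \<and> card (set (take (r n) xs) \<inter> W) < l) \<le>
    K * ln (real n) ^ l * dens d n ^ j * exp (- (real (card W) * real (r n) / real (n choose d)))"
proof -
  have "\<forall>\<^sub>F n in sequentially. real (j + l) \<le> real ((n - 1) choose (d - 1))"
    using filterlim_star_degree[OF d] by (simp add: filterlim_at_top)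
  moreover have "\<forall>\<^sub>F n in sequentially. j + l \<le> r n"
    using r by (simp add: filterlim_at_top)
  moreover have "\<forall>\<^sub>F n in sequentially. real (j + l) * (2 * real d / real n + dens d n) < 1"
  proof (rule order_tendstoD)
    have "(\<lambda>n. real (j + l) * (2 * real d / real n + dens d n)) \<longlonglongrightarrow> real (j + l) * (0 + 0)"
      by (intro tendsto_intros dens_tendsto_0 d)
    then show "(\<lambda>n. real (j + l) * (2 * real d / real n + dens d n)) \<longlonglongrightarrow> 0" by simp
  qed simp
  moreover have "\<forall>\<^sub>F n::nat in sequentially. 1 \<le> ln (real n)"
    by real_asymp
  ultimately show ?thesis
    using eventually_m_hi_le[OF d] r_le eventually_ge_at_top[of d]
  proof eventually_elim
    case (elim n)
    define N where "N = real (n choose d)"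
    have n: "1 \<le> n" and N: "0 < N" using elim d by (auto simp: N_def)
    have deg: "real ((n - 1) choose (d - 1)) = real d * N / real n"
      using degree_product[of d n] d n by (simp add: N_def field_simps)
    show ?case
    proof (intro allI impI)
      fix J W assume J: "J \<subseteq> all_edges d n" "card J = j" and W: "W \<subseteq> all_edges d n"
        "(n - 1) choose (d - 1) \<le> card W" "card W \<le> 2 * ((n - 1) choose (d - 1))"
      define w where "w = real (card W)"
      define A where "A = real (card W - j - l) * real (r n - j - l) / N"
      have "real (card W) \<le> 2 * real ((n - 1) choose (d - 1))" using W(3) by linarith
      then have w: "w \<le> 2 * real d * N / real n" unfolding w_def deg by simp
      have "perm_prob (all_edges d n)
          (\<lambda>xs. J \<subseteq> set (take (m_hi n) xs) \<and> card (set (take (r n) xs) \<inter> W) < l) \<le>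
        l * (1 + w * dens d n) ^ l * dens d n ^ j * exp (- A)"
        using perm_prob_few_le[of "all_edges d n" J W "r n" "m_hi n" l] J W elim
        by (simp add: card_all_edges w_def dens_def A_def N_def)
      also have "\<dots> \<le> l * ((4 * real d + 1) * ln (real n)) ^ l * dens d n ^ j *
          (exp 1 * exp (- (w * r n / N)))"
      proof (intro mult_mono power_mono order_refl mult_nonneg_nonneg)
        have "w * dens d n \<le> 2 * real d * N / real n * (2 * real n * ln (real n) / N)"
          unfolding dens_def N_def[symmetric] using w m_hi_le[OF n] N
          by (intro mult_mono divide_right_mono) (auto simp: w_def)
        also have "\<dots> = 4 * real d * ln (real n)" using N n by simp
        finally show "1 + w * dens d n \<le> (4 * real d + 1) * ln (real n)"
          using elim by (simp add: algebra_simps)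
        \<comment> \<open>Expanding the product, the loss is at most
          \<open>(j + l) * (w + r n) / N\<close>, which is eventually below 1 since both
          \<open>w / N\<close> and \<open>r n / N\<close> vanish.\<close>
        have "w * r n / N - 1 \<le> A"
        proof -
          have "w * r n - real (j + l) * (w + r n) \<le> (w - real (j + l)) * (r n - real (j + l))"
            by (simp add: algebra_simps)
          also have "\<dots> = real (card W - j - l) * real (r n - j - l)"
            using elim W(2) by (simp add: w_def of_nat_diff)
          finally have "(w * r n - real (j + l) * (w + r n)) / N \<le> A"
            unfolding A_def using N by (intro divide_right_mono) auto
          moreover have "(w + r n) / N \<le> 2 * real d / real n + dens d n"
          proof -
            have "w / N \<le> 2 * real d / real n" using w N n by (simp add: field_simps)
            moreover have "r n / N \<le> dens d n"
              using elim N unfolding dens_def N_def[symmetric] by (intro divide_right_mono) auto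
            ultimately show ?thesis by (simp add: add_divide_distrib)
          qed
          then have "real (j + l) * ((w + r n) / N) \<le> real (j + l) * (2 * real d / real n + dens d n)"
            by (rule mult_left_mono) simp
          with elim(3) have "real (j + l) * ((w + r n) / N) \<le> 1"
            by (meson less_imp_le order_trans)
          ultimately show ?thesis by (simp add: diff_divide_distrib)
        qed
        then show "exp (- A) \<le> exp 1 * exp (- (w * r n / N))"
          by (simp flip: exp_add)
      qed (use dens_nonneg elim in \<open>auto simp: w_def\<close>)
      also have "\<dots> = K * ln (real n) ^ l * dens d n ^ j * exp (- (w * r n / N))"
        by (simp add: K_def power_mult_distrib)
      finally show "perm_prob (all_edges d n)
          (\<lambda>xs. J \<subseteq> set (take (m_hi n) xs) \<and> card (set (take (r n) xs) \<inter> W) < l) \<le>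
        K * ln (real n) ^ l * dens d n ^ j * exp (- (real (card W) * real (r n) / real (n choose d)))"
        by (simp add: w_def N_def)
    qed
  qed
qed

lemma perm_prob_tendsto_0:
  assumes "\<forall>\<^sub>F n in sequentially. perm_prob (E n) (Q n) \<le> g n" "g \<longlonglongrightarrow> 0"
  shows "(\<lambda>n. perm_prob (E n) (Q n)) \<longlonglongrightarrow> 0"
  using assms by (intro tendsto_sandwich[OF _ _ tendsto_const assms(2)]) (auto simp: perm_prob_nonneg)

lemma star_exponent:
  assumes "2 \<le> d" "d \<le> n"
  shows "real ((n - 1) choose (d - 1)) * real m / real (n choose d) = real d * real m / real n"
  using degree_product[of d n] assms by (simp add: field_simps)

lemma eventually_m_lo_le_m_hi:
  assumes "1 \<le> d"
  shows "\<forall>\<^sub>F n in sequentially. m_lo d n \<le> m_hi n"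
  using assms by (intro eventually_mono[OF eventually_ge_at_top[of 1]] m_lo_le_m_hi)

lemma perm_prob_include_le:
  assumes "finite E" "J \<subseteq> E" "m \<le> card E"
  shows "perm_prob E (\<lambda>xs. J \<subseteq> set (take m xs)) \<le> (m / card E) ^ card J"
  using perm_prob_include_avoid_le[OF assms(1,2), of "{}" m m] assms(3) by simp

text \<open>The mean degree at the lower time is about 3/4 ln n, which gives the power of n. Each
  required edge contributes a factor \<open>dens d n\<close>, as under independence. The value of
  \<open>K\<close> never matters, so it is hidden.\<close>

lemma ex_one_low_le:
  assumes d: "2 \<le> d"
  shows "\<exists>K\<ge>0. \<forall>\<^sub>F n in sequentially. \<forall>v\<in>{1..n}. \<forall>J. J \<subseteq> all_edges d n \<longrightarrow> card J = j \<longrightarrow>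
    perm_prob (all_edges d n)
      (\<lambda>xs. J \<subseteq> set (take (m_hi n) xs) \<and> hg_degree (set (take (m_lo d n) xs)) v < L) \<le>
    K * ln (real n) ^ L * dens d n ^ j * real n powr (-3/4)"
proof -
  define K where "K = real L * (4 * real d + 1) ^ L * exp 1"
  have "\<forall>\<^sub>F n in sequentially. \<forall>J W. J \<subseteq> all_edges d n \<longrightarrow> card J = j \<longrightarrow> W \<subseteq> all_edges d n \<longrightarrow>
    (n - 1) choose (d - 1) \<le> card W \<longrightarrow> card W \<le> 2 * ((n - 1) choose (d - 1)) \<longrightarrow>
    perm_prob (all_edges d n)
      (\<lambda>xs. J \<subseteq> set (take (m_hi n) xs) \<and> card (set (take (m_lo d n) xs) \<inter> W) < L) \<le>
    K * ln (real n) ^ L * dens d n ^ j * exp (- (real (card W) * real (m_lo d n) / real (n choose d)))"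
    unfolding K_def using d by (intro eventually_few_le filterlim_m_lo eventually_m_lo_le_m_hi) auto
  then have "\<forall>\<^sub>F n in sequentially. \<forall>v\<in>{1..n}. \<forall>J. J \<subseteq> all_edges d n \<longrightarrow> card J = j \<longrightarrow>
    perm_prob (all_edges d n)
      (\<lambda>xs. J \<subseteq> set (take (m_hi n) xs) \<and> hg_degree (set (take (m_lo d n) xs)) v < L) \<le>
    K * exp 1 * ln (real n) ^ L * dens d n ^ j * real n powr (-3/4)"
    using eventually_ge_at_top[of d]
  proof eventually_elim
    case (elim n)
    show ?case
    proof (intro ballI allI impI)
      fix v J assume v: "v \<in> {1..n}" and J: "J \<subseteq> all_edges d n" "card J = j"
      have n: "1 \<le> n" "0 < real n" using elim d by auto
      have cW: "card (star d n v) = (n - 1) choose (d - 1)"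
        using card_star[OF v] d by simp
      have sW: "star d n v \<subseteq> all_edges d n" by (auto simp: star_def)
      have "perm_prob (all_edges d n)
          (\<lambda>xs. J \<subseteq> set (take (m_hi n) xs) \<and> hg_degree (set (take (m_lo d n) xs)) v < L) =
        perm_prob (all_edges d n)
          (\<lambda>xs. J \<subseteq> set (take (m_hi n) xs) \<and> card (set (take (m_lo d n) xs) \<inter> star d n v) < L)"
        by (intro perm_prob_cong) (simp add: hg_degree_eq_card_Int_star[OF set_take_subset_permutation])
      also have "\<dots> \<le> K * ln (real n) ^ L * dens d n ^ j *
          exp (- (real (card (star d n v)) * real (m_lo d n) / real (n choose d)))"
        using elim(1)[rule_format, OF J sW] cW by simp
      also have "\<dots> \<le> K * ln (real n) ^ L * dens d n ^ j * (exp 1 * real n powr (-3/4))"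
      proof (intro mult_left_mono)
        \<comment> \<open>Rounding in \<open>m_lo\<close> costs at most d / n \<le> 1 in the
          exponent, which accounts for the extra factor \<open>exp 1\<close>.\<close>
        have "3/4 * ln (real n) - 1 \<le> real d * (3/4 * (real n / real d) * ln (real n) - 1) / real n"
          using elim d n by (simp add: field_simps)
        also have "\<dots> \<le> real d * m_lo d n / real n"
          by (intro divide_right_mono mult_left_mono m_lo_ge) auto
        finally have "exp (- (real d * m_lo d n / real n)) \<le> exp (1 + (- 3/4) * ln (real n))"
          by simp
        also have "\<dots> = exp 1 * real n powr (-3/4)"
          using n by (simp add: powr_def flip: exp_add)
        finally show "exp (- (real (card (star d n v)) * real (m_lo d n) / real (n choose d))) \<le> exp 1 * real n powr (-3/4)"
          unfolding cW star_exponent[OF d elim(2)] .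
      qed (use n in \<open>auto simp: K_def dens_nonneg\<close>)
      finally show "perm_prob (all_edges d n)
          (\<lambda>xs. J \<subseteq> set (take (m_hi n) xs) \<and> hg_degree (set (take (m_lo d n) xs)) v < L) \<le>
        K * exp 1 * ln (real n) ^ L * dens d n ^ j * real n powr (-3/4)"
        by (simp add: mult_ac)
    qed
  qed
  moreover have "0 \<le> K * exp 1" by (simp add: K_def)
  ultimately show ?thesis by blast
qed

text \<open>If both degrees are below \<open>L\<close>, the union of the two stars is hit fewer than
  \<open>2 * L\<close> times. The stars overlap so little that the exponent of a single star doubles
  up to a bounded error.\<close>

lemma ex_two_low_le:
  assumes d: "2 \<le> d"
  shows "\<exists>K\<ge>0. \<forall>\<^sub>F n in sequentially. \<forall>u\<in>{1..n}. \<forall>v\<in>{1..n}. \<forall>J. u \<noteq> v \<longrightarrow>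
    J \<subseteq> all_edges d n \<longrightarrow> card J = j \<longrightarrow>
    perm_prob (all_edges d n)
      (\<lambda>xs. J \<subseteq> set (take (m_hi n) xs) \<and> hg_degree (set (take (m_lo d n) xs)) u < L \<and>
        hg_degree (set (take (m_lo d n) xs)) v < L) \<le>
    K * ln (real n) ^ (2 * L) * dens d n ^ j * real n powr (-3/2)"
proof -
  define K where "K = real (2 * L) * (4 * real d + 1) ^ (2 * L) * exp 1"
  have "\<forall>\<^sub>F n in sequentially. \<forall>J W. J \<subseteq> all_edges d n \<longrightarrow> card J = j \<longrightarrow> W \<subseteq> all_edges d n \<longrightarrow>
    (n - 1) choose (d - 1) \<le> card W \<longrightarrow> card W \<le> 2 * ((n - 1) choose (d - 1)) \<longrightarrow>
    perm_prob (all_edges d n)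
      (\<lambda>xs. J \<subseteq> set (take (m_hi n) xs) \<and> card (set (take (m_lo d n) xs) \<inter> W) < 2 * L) \<le>
    K * ln (real n) ^ (2 * L) * dens d n ^ j * exp (- (real (card W) * real (m_lo d n) / real (n choose d)))"
    unfolding K_def using d by (intro eventually_few_le filterlim_m_lo eventually_m_lo_le_m_hi) auto
  \<comment> \<open>The left side will bound \<open>D2 * m_lo d n / N\<close>, the mean number of
    edges through two given vertices. It tends to 0, but the bound 1 is enough.\<close>
  moreover have "\<forall>\<^sub>F n::nat in sequentially. 3/4 * real (d - 1) * ln (real n) / (real n - 1) \<le> 1"
    by real_asymp
  ultimately have "\<forall>\<^sub>F n in sequentially. \<forall>u\<in>{1..n}. \<forall>v\<in>{1..n}. \<forall>J. u \<noteq> v \<longrightarrow>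
    J \<subseteq> all_edges d n \<longrightarrow> card J = j \<longrightarrow>
    perm_prob (all_edges d n)
      (\<lambda>xs. J \<subseteq> set (take (m_hi n) xs) \<and> hg_degree (set (take (m_lo d n) xs)) u < L \<and>
        hg_degree (set (take (m_lo d n) xs)) v < L) \<le>
    K * exp 3 * ln (real n) ^ (2 * L) * dens d n ^ j * real n powr (-3/2)"
    using eventually_ge_at_top[of d]
  proof eventually_elim
    case (elim n)
    show ?case
    proof (intro ballI allI impI)
      fix u v J assume u: "u \<in> {1..n}" and v: "v \<in> {1..n}" and uv: "u \<noteq> v"
        and J: "J \<subseteq> all_edges d n" "card J = j"
      define W where "W = star d n u \<union> star d n v"
      define D where "D = (n - 1) choose (d - 1)"
      define D2 where "D2 = (n - 2) choose (d - 2)"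
      define N where "N = real (n choose d)"
      have n: "2 \<le> n" "0 < real n" using elim d by auto
      have N: "0 < N" using elim by (simp add: N_def)
      have cW: "card W + D2 = 2 * D"
        using card_star_Un[OF u v uv d] by (simp add: W_def D_def D2_def)
      have "card (star d n u) \<le> card W" unfolding W_def by (intro card_mono) auto
      then have DW: "D \<le> card W" using card_star[OF u] d by (simp add: D_def)
      have D2: "(real n - 1) * real D2 = (real d - 1) * real D"
        using degree_product[of "d - 1" "n - 1"] d n by (simp add: D_def D2_def of_nat_diff numeral_2_eq_2)
      have "perm_prob (all_edges d n)
        (\<lambda>xs. J \<subseteq> set (take (m_hi n) xs) \<and> hg_degree (set (take (m_lo d n) xs)) u < L \<and>
          hg_degree (set (take (m_lo d n) xs)) v < L) \<le>
        perm_prob (all_edges d n)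
          (\<lambda>xs. J \<subseteq> set (take (m_hi n) xs) \<and> card (set (take (m_lo d n) xs) \<inter> W) < 2 * L)"
      proof (rule perm_prob_mono)
        fix xs assume xs: "xs \<in> permutations_of_set (all_edges d n)"
          and *: "J \<subseteq> set (take (m_hi n) xs) \<and> hg_degree (set (take (m_lo d n) xs)) u < L \<and>
          hg_degree (set (take (m_lo d n) xs)) v < L"
        have "card (set (take (m_lo d n) xs) \<inter> W) \<le>
            hg_degree (set (take (m_lo d n) xs)) u + hg_degree (set (take (m_lo d n) xs)) v"
          unfolding W_def Int_Un_distrib hg_degree_eq_card_Int_star[OF set_take_subset_permutation[OF xs]]
          by (rule card_Un_le)
        then show "J \<subseteq> set (take (m_hi n) xs) \<and> card (set (take (m_lo d n) xs) \<inter> W) < 2 * L"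
          using * by auto
      qed
      also have "\<dots> \<le> K * ln (real n) ^ (2 * L) * dens d n ^ j * exp (- (real (card W) * real (m_lo d n) / real (n choose d)))"
        using elim(1) J cW DW by (auto simp: star_def W_def D_def)
      also have "\<dots> \<le> K * ln (real n) ^ (2 * L) * dens d n ^ j * (exp 3 * real n powr (-3/2))"
      proof (intro mult_left_mono)
        have D: "real D * real (m_lo d n) / N = real d * real (m_lo d n) / real n"
          using star_exponent[OF d elim(3)] by (simp add: D_def N_def)
        have "3/4 * ln (real n) - 1 \<le> real d * (3/4 * (real n / real d) * ln (real n) - 1) / real n"
          using elim d n by (simp add: field_simps)
        also have "\<dots> \<le> real d * m_lo d n / real n"
          by (intro divide_right_mono mult_left_mono m_lo_ge) auto
        finally have lo: "3/4 * ln (real n) - 1 \<le> real D * m_lo d n / N"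
          by (simp only: D)
        have "real d * m_lo d n / real n \<le> real d * (3/4 * (real n / real d) * ln (real n)) / real n"
          using n by (intro divide_right_mono mult_left_mono m_lo_le) auto
        also have "\<dots> = 3/4 * ln (real n)" using d n by simp
        finally have hi: "real D * m_lo d n / N \<le> 3/4 * ln (real n)"
          by (simp only: D)
        have "real D2 * m_lo d n / N = (real d - 1) / (real n - 1) * (real D * m_lo d n / N)"
        proof -
          have "real D2 = (real d - 1) / (real n - 1) * real D"
            using D2 n by (simp add: field_simps)
          then show ?thesis by simp
        qed
        also have "\<dots> \<le> (real d - 1) / (real n - 1) * (3/4 * ln (real n))"
          using hi d n by (intro mult_left_mono) auto
        also have "\<dots> = 3/4 * real (d - 1) * ln (real n) / (real n - 1)"
        proof -
          have "real (d - 1) = real d - 1" using d by simp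
          moreover have "x / y * (c * z) = c * x * z / y" for c x y z :: real by simp
          ultimately show ?thesis by metis
        qed
        also have "\<dots> \<le> 1" by (rule elim(2))
        finally have "real D2 * m_lo d n / N \<le> 1" .
        moreover have "card W * m_lo d n / N = 2 * (real D * m_lo d n / N) - real D2 * m_lo d n / N"
        proof -
          have "real (card W) = 2 * real D - real D2" using cW by linarith
          then show ?thesis by (simp add: left_diff_distrib diff_divide_distrib)
        qed
        \<comment> \<open>The 3 collects one unit of rounding for each star and one unit for the
          overlap.\<close>
        ultimately have "3/2 * ln (real n) - 3 \<le> card W * m_lo d n / N"
          using lo by linarith
        then have "exp (- (card W * m_lo d n / N)) \<le> exp (3 + (- 3/2) * ln (real n))"
          by simp
        also have "\<dots> = exp 3 * real n powr (-3/2)"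
          using n by (simp add: powr_def flip: exp_add)
        finally show "exp (- (real (card W) * real (m_lo d n) / real (n choose d))) \<le> exp 3 * real n powr (-3/2)"
          by (simp add: N_def)
      qed (use n in \<open>auto simp: K_def dens_nonneg\<close>)
      finally show "perm_prob (all_edges d n)
        (\<lambda>xs. J \<subseteq> set (take (m_hi n) xs) \<and> hg_degree (set (take (m_lo d n) xs)) u < L \<and>
          hg_degree (set (take (m_lo d n) xs)) v < L) \<le>
        K * exp 3 * ln (real n) ^ (2 * L) * dens d n ^ j * real n powr (-3/2)"
        by (simp add: mult_ac)
    qed
  qed
  moreover have "0 \<le> K * exp 3" by (simp add: K_def)
  ultimately show ?thesis by blast
qed

section \<open>Union bounds for the exceptional degree and codegree events\<close>

lemma prob_small_degree_m_hi_tendsto_0: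
  assumes d: "2 \<le> d"
  shows "(\<lambda>n. perm_prob (all_edges d n)
    (\<lambda>xs. \<exists>v\<in>{1..n}. hg_degree (set (take (m_hi n) xs)) v < k)) \<longlonglongrightarrow> 0"
proof -
  define K where "K = real k * (4 * real d + 1) ^ k * exp 1"
  have "\<forall>\<^sub>F n in sequentially. \<forall>J W. J \<subseteq> all_edges d n \<longrightarrow> card J = 0 \<longrightarrow> W \<subseteq> all_edges d n \<longrightarrow>
    (n - 1) choose (d - 1) \<le> card W \<longrightarrow> card W \<le> 2 * ((n - 1) choose (d - 1)) \<longrightarrow>
    perm_prob (all_edges d n)
      (\<lambda>xs. J \<subseteq> set (take (m_hi n) xs) \<and> card (set (take (m_hi n) xs) \<inter> W) < k) \<le>
    K * ln (real n) ^ k * dens d n ^ 0 * exp (- (real (card W) * real (m_hi n) / real (n choose d)))"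
    unfolding K_def using d by (intro eventually_few_le filterlim_m_hi) auto
  then have "\<forall>\<^sub>F n in sequentially. perm_prob (all_edges d n)
    (\<lambda>xs. \<exists>v\<in>{1..n}. hg_degree (set (take (m_hi n) xs)) v < k) \<le>
    real n * (K * ln (real n) ^ k * (exp 1 * real n powr (-4)))"
    using eventually_ge_at_top[of d]
  proof eventually_elim
    case (elim n)
    have n: "1 \<le> n" "0 < real n" "0 \<le> ln (real n)" using elim d by auto
    show ?case
    proof (rule perm_prob_Bex_le)
      fix v assume v: "v \<in> {1..n}"
      have cW: "card (star d n v) = (n - 1) choose (d - 1)"
        using card_star[OF v] d by simp
      have sW: "star d n v \<subseteq> all_edges d n" by (auto simp: star_def)
      have "perm_prob (all_edges d n) (\<lambda>xs. hg_degree (set (take (m_hi n) xs)) v < k) =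
        perm_prob (all_edges d n)
          (\<lambda>xs. {} \<subseteq> set (take (m_hi n) xs) \<and> card (set (take (m_hi n) xs) \<inter> star d n v) < k)"
        by (intro perm_prob_cong) (simp add: hg_degree_eq_card_Int_star[OF set_take_subset_permutation])
      also have "\<dots> \<le> K * ln (real n) ^ k * dens d n ^ 0 *
          exp (- (real (card (star d n v)) * real (m_hi n) / real (n choose d)))"
        using elim(1)[rule_format, OF _ _ sW, of "{}"] cW by simp
      also have "\<dots> = K * ln (real n) ^ k * exp (- (real (card (star d n v)) * real (m_hi n) / real (n choose d)))"
        by simp
      also have "\<dots> \<le> K * ln (real n) ^ k * (exp 1 * real n powr (-4))"
      proof (intro mult_left_mono)
        \<comment> \<open>Uses \<open>2 * d \<ge> 4\<close> and d / n \<le> 1; the resulting n^(-4)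
          easily beats the n choices of a vertex.\<close>
        have "4 * ln (real n) - 1 \<le> 2 * real d * ln (real n) - real d / real n"
          using elim(2) d n by (intro diff_mono mult_right_mono) auto
        also have "\<dots> = real d * (2 * real n * ln (real n) - 1) / real n"
          using n by (simp add: field_simps)
        also have "\<dots> \<le> real d * m_hi n / real n"
          by (intro divide_right_mono mult_left_mono m_hi_ge) auto
        finally have "exp (- (real d * m_hi n / real n)) \<le> exp (1 + (- 4) * ln (real n))"
          by simp
        also have "\<dots> = exp 1 * real n powr (-4)"
          using n by (simp add: powr_def flip: exp_add)
        finally show "exp (- (real (card (star d n v)) * real (m_hi n) / real (n choose d))) \<le> exp 1 * real n powr (-4)"
          unfolding cW star_exponent[OF d elim(2)] .
      qed (use n in \<open>auto simp: K_def\<close>)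
      finally show "perm_prob (all_edges d n) (\<lambda>xs. hg_degree (set (take (m_hi n) xs)) v < k) \<le>
        K * ln (real n) ^ k * (exp 1 * real n powr (-4))" .
    qed (use n in \<open>auto simp: K_def\<close>)
  qed
  then show ?thesis
    by (rule perm_prob_tendsto_0) real_asymp
qed

text \<open>The unit of the following counts: choosing one vertex, choosing an edge through it and
  another given vertex, and having this edge present cost together only a logarithm.\<close>

lemma dens_power_le:
  assumes "2 \<le> d" "d \<le> n"
  shows "(real n * real n ^ (d - 2) * dens d n) ^ j \<le> (2 * real d ^ d * ln (real n)) ^ j"
proof -
  have "real n * real n ^ (d - 2) = real n ^ (d - 1)"
    using assms by (metis Suc_diff_Suc Suc_1 Suc_le_eq power_Suc)
  then show ?thesis
    using dens_le[of d n] assms by (intro power_mono) (auto simp: dens_nonneg)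
qed

text \<open>Two vertices with t common edges contribute a power of ln n times n^(2 - t). At t = 2
  this does not vanish, so t = 3 is the least number this count can exclude, and low vertices need a
  separate bound. Each quantifier excludes earlier choices, which keeps the edges distinct.\<close>

lemma prob_codegree_tendsto_0:
  assumes d: "2 \<le> d"
  shows "(\<lambda>n. perm_prob (all_edges d n) (\<lambda>xs. \<exists>u\<in>{1..n}. \<exists>w\<in>{1..n} - {u}.
    \<exists>e\<in>star d n u \<inter> star d n w. \<exists>f\<in>star d n u \<inter> star d n w - {e}.
    \<exists>g\<in>star d n u \<inter> star d n w - {e, f}. {e, f, g} \<subseteq> set (take (m_hi n) xs))) \<longlonglongrightarrow> 0"
proof -
  have "\<forall>\<^sub>F n in sequentially. perm_prob (all_edges d n) (\<lambda>xs. \<exists>u\<in>{1..n}. \<exists>w\<in>{1..n} - {u}.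
    \<exists>e\<in>star d n u \<inter> star d n w. \<exists>f\<in>star d n u \<inter> star d n w - {e}.
    \<exists>g\<in>star d n u \<inter> star d n w - {e, f}. {e, f, g} \<subseteq> set (take (m_hi n) xs)) \<le>
    (2 * real d ^ d) ^ 3 * ln (real n) ^ 3 / real n"
    using eventually_ge_at_top[of d] eventually_m_hi_le[OF d]
  proof eventually_elim
    case (elim n)
    define q where "q = real n ^ (d - 2)"
    have n: "0 < real n" using elim d by auto
    have "perm_prob (all_edges d n) (\<lambda>xs. \<exists>u\<in>{1..n}. \<exists>w\<in>{1..n} - {u}.
      \<exists>e\<in>star d n u \<inter> star d n w. \<exists>f\<in>star d n u \<inter> star d n w - {e}.
      \<exists>g\<in>star d n u \<inter> star d n w - {e, f}. {e, f, g} \<subseteq> set (take (m_hi n) xs)) \<le>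
      real n * (real n * (q * (q * (q * dens d n ^ 3))))"
    proof (rule perm_prob_Bex_le; (rule perm_prob_Bex_le)?; (rule perm_prob_Bex_le)?;
        (rule perm_prob_Bex_le)?; (rule perm_prob_Bex_le)?)
      fix u w e f g assume *: "u \<in> {1..n}" "w \<in> {1..n} - {u}" "e \<in> star d n u \<inter> star d n w"
        "f \<in> star d n u \<inter> star d n w - {e}" "g \<in> star d n u \<inter> star d n w - {e, f}"
      have "perm_prob (all_edges d n) (\<lambda>xs. {e, f, g} \<subseteq> set (take (m_hi n) xs)) \<le>
        dens d n ^ card {e, f, g}"
        unfolding dens_def card_all_edges[symmetric] using * elim
        by (intro perm_prob_include_le) (auto simp: star_def card_all_edges)
      also have "card {e, f, g} = 3"
        using * by (simp add: card_insert_if numeral_3_eq_3) blast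
      finally show "perm_prob (all_edges d n) (\<lambda>xs. {e, f, g} \<subseteq> set (take (m_hi n) xs)) \<le> dens d n ^ 3" .
    next
      fix u w assume *: "u \<in> {1..n}" "w \<in> {1..n} - {u}"
      then show "real (card (star d n u \<inter> star d n w)) \<le> q"
        unfolding q_def using d by (intro card_star_Int_le) auto
      fix e
      show "real (card (star d n u \<inter> star d n w - {e})) \<le> q"
        using \<open>real (card (star d n u \<inter> star d n w)) \<le> q\<close>
          card_mono[of "star d n u \<inter> star d n w" "star d n u \<inter> star d n w - {e}"] by fastforce
      fix f
      show "real (card (star d n u \<inter> star d n w - {e, f})) \<le> q"
        using \<open>real (card (star d n u \<inter> star d n w)) \<le> q\<close>
          card_mono[of "star d n u \<inter> star d n w" "star d n u \<inter> star d n w - {e, f}"] by fastforce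
    qed (auto simp: q_def dens_nonneg)
    also have "\<dots> = (real n * q * dens d n) ^ 3 / real n"
      using n by (simp add: power3_eq_cube field_simps)
    also have "\<dots> \<le> (2 * real d ^ d) ^ 3 * ln (real n) ^ 3 / real n"
      unfolding q_def power_mult_distrib[of "2 * real d ^ d", symmetric]
      using n elim by (intro divide_right_mono dens_power_le d) auto
    finally show ?case .
  qed
  then show ?thesis
    by (rule perm_prob_tendsto_0) real_asymp
qed

text \<open>Two common edges leave a power of ln n in the count; the factor n^(-3/4) for the low
  vertex makes it vanish.\<close>

lemma prob_low_codegree_tendsto_0:
  assumes d: "2 \<le> d"
  shows "(\<lambda>n. perm_prob (all_edges d n) (\<lambda>xs. \<exists>u\<in>{1..n}. \<exists>w\<in>{1..n} - {u}.
    \<exists>e\<in>star d n u \<inter> star d n w. \<exists>f\<in>star d n u \<inter> star d n w - {e}.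
    {e, f} \<subseteq> set (take (m_hi n) xs) \<and> hg_degree (set (take (m_lo d n) xs)) u < L)) \<longlonglongrightarrow> 0"
proof -
  obtain K where K: "0 \<le> K" and ev:
    "\<forall>\<^sub>F n in sequentially. \<forall>v\<in>{1..n}. \<forall>J. J \<subseteq> all_edges d n \<longrightarrow> card J = 2 \<longrightarrow>
    perm_prob (all_edges d n)
      (\<lambda>xs. J \<subseteq> set (take (m_hi n) xs) \<and> hg_degree (set (take (m_lo d n) xs)) v < L) \<le>
    K * ln (real n) ^ L * dens d n ^ 2 * real n powr (-3/4)"
    using ex_one_low_le[OF d] by blast
  from ev have "\<forall>\<^sub>F n in sequentially. perm_prob (all_edges d n) (\<lambda>xs. \<exists>u\<in>{1..n}. \<exists>w\<in>{1..n} - {u}.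
    \<exists>e\<in>star d n u \<inter> star d n w. \<exists>f\<in>star d n u \<inter> star d n w - {e}.
    {e, f} \<subseteq> set (take (m_hi n) xs) \<and> hg_degree (set (take (m_lo d n) xs)) u < L) \<le>
    K * ln (real n) ^ L * ((2 * real d ^ d) ^ 2 * ln (real n) ^ 2) * real n powr (-3/4)"
    using eventually_ge_at_top[of d]
  proof eventually_elim
    case (elim n)
    define q where "q = real n ^ (d - 2)"
    define b where "b = K * ln (real n) ^ L * dens d n ^ 2 * real n powr (-3/4)"
    have n: "0 < real n" "0 \<le> ln (real n)" using elim d by auto
    have "perm_prob (all_edges d n) (\<lambda>xs. \<exists>u\<in>{1..n}. \<exists>w\<in>{1..n} - {u}.
      \<exists>e\<in>star d n u \<inter> star d n w. \<exists>f\<in>star d n u \<inter> star d n w - {e}.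
      {e, f} \<subseteq> set (take (m_hi n) xs) \<and> hg_degree (set (take (m_lo d n) xs)) u < L) \<le>
      real n * (real n * (q * (q * b)))"
    proof (rule perm_prob_Bex_le; (rule perm_prob_Bex_le)?; (rule perm_prob_Bex_le)?;
        (rule perm_prob_Bex_le)?)
      fix u w e f assume *: "u \<in> {1..n}" "w \<in> {1..n} - {u}" "e \<in> star d n u \<inter> star d n w"
        "f \<in> star d n u \<inter> star d n w - {e}"
      show "perm_prob (all_edges d n)
          (\<lambda>xs. {e, f} \<subseteq> set (take (m_hi n) xs) \<and> hg_degree (set (take (m_lo d n) xs)) u < L) \<le> b"
        unfolding b_def using * by (intro elim(1)[rule_format]) (auto simp: star_def card_insert_if)
    next
      fix u w assume *: "u \<in> {1..n}" "w \<in> {1..n} - {u}"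
      then show "real (card (star d n u \<inter> star d n w)) \<le> q"
        unfolding q_def using d by (intro card_star_Int_le) auto
      fix e
      show "real (card (star d n u \<inter> star d n w - {e})) \<le> q"
        using \<open>real (card (star d n u \<inter> star d n w)) \<le> q\<close>
          card_mono[of "star d n u \<inter> star d n w" "star d n u \<inter> star d n w - {e}"] by fastforce
    qed (use n K in \<open>auto simp: q_def b_def dens_nonneg\<close>)
    also have "\<dots> = K * ln (real n) ^ L * (real n * q * dens d n) ^ 2 * real n powr (-3/4)"
      by (simp only: power2_eq_square b_def mult_ac)
    also have "\<dots> \<le> K * ln (real n) ^ L * ((2 * real d ^ d) ^ 2 * ln (real n) ^ 2) * real n powr (-3/4)"
      unfolding q_def power_mult_distrib[of "2 * real d ^ d", symmetric]
      using n elim K by (intro mult_right_mono mult_left_mono dens_power_le d) auto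
    finally show ?case .
  qed
  then show ?thesis
    by (rule perm_prob_tendsto_0) real_asymp
qed

text \<open>Two vertices and one edge contribute n ln n up to a constant, against n^(-3/2) for two
  low vertices.\<close>

lemma prob_low_adjacent_tendsto_0:
  assumes d: "2 \<le> d"
  shows "(\<lambda>n. perm_prob (all_edges d n) (\<lambda>xs. \<exists>u\<in>{1..n}. \<exists>v\<in>{1..n} - {u}.
    \<exists>e\<in>star d n u \<inter> star d n v. {e} \<subseteq> set (take (m_hi n) xs) \<and>
    hg_degree (set (take (m_lo d n) xs)) u < L \<and> hg_degree (set (take (m_lo d n) xs)) v < L)) \<longlonglongrightarrow> 0"
proof -
  obtain K where K: "0 \<le> K" and ev:
    "\<forall>\<^sub>F n in sequentially. \<forall>u\<in>{1..n}. \<forall>v\<in>{1..n}. \<forall>J. u \<noteq> v \<longrightarrow>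
    J \<subseteq> all_edges d n \<longrightarrow> card J = 1 \<longrightarrow>
    perm_prob (all_edges d n)
      (\<lambda>xs. J \<subseteq> set (take (m_hi n) xs) \<and> hg_degree (set (take (m_lo d n) xs)) u < L \<and>
        hg_degree (set (take (m_lo d n) xs)) v < L) \<le>
    K * ln (real n) ^ (2 * L) * dens d n ^ 1 * real n powr (-3/2)"
    using ex_two_low_le[OF d] by blast
  from ev have "\<forall>\<^sub>F n in sequentially. perm_prob (all_edges d n) (\<lambda>xs. \<exists>u\<in>{1..n}. \<exists>v\<in>{1..n} - {u}.
    \<exists>e\<in>star d n u \<inter> star d n v. {e} \<subseteq> set (take (m_hi n) xs) \<and>
    hg_degree (set (take (m_lo d n) xs)) u < L \<and> hg_degree (set (take (m_lo d n) xs)) v < L) \<le>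
    real n * (K * ln (real n) ^ (2 * L) * ((2 * real d ^ d) ^ 1 * ln (real n) ^ 1) * real n powr (-3/2))"
    using eventually_ge_at_top[of d]
  proof eventually_elim
    case (elim n)
    define q where "q = real n ^ (d - 2)"
    define b where "b = K * ln (real n) ^ (2 * L) * dens d n ^ 1 * real n powr (-3/2)"
    have n: "0 < real n" "0 \<le> ln (real n)" using elim d by auto
    have "perm_prob (all_edges d n) (\<lambda>xs. \<exists>u\<in>{1..n}. \<exists>v\<in>{1..n} - {u}.
      \<exists>e\<in>star d n u \<inter> star d n v. {e} \<subseteq> set (take (m_hi n) xs) \<and>
      hg_degree (set (take (m_lo d n) xs)) u < L \<and> hg_degree (set (take (m_lo d n) xs)) v < L) \<le>
      real n * (real n * (q * b))"
    proof (rule perm_prob_Bex_le; (rule perm_prob_Bex_le)?; (rule perm_prob_Bex_le)?)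
      fix u v e assume *: "u \<in> {1..n}" "v \<in> {1..n} - {u}" "e \<in> star d n u \<inter> star d n v"
      show "perm_prob (all_edges d n) (\<lambda>xs. {e} \<subseteq> set (take (m_hi n) xs) \<and>
          hg_degree (set (take (m_lo d n) xs)) u < L \<and> hg_degree (set (take (m_lo d n) xs)) v < L) \<le> b"
        unfolding b_def using * by (intro elim(1)[rule_format]) (auto simp: star_def)
    next
      fix u v assume *: "u \<in> {1..n}" "v \<in> {1..n} - {u}"
      then show "real (card (star d n u \<inter> star d n v)) \<le> q"
        unfolding q_def using d by (intro card_star_Int_le) auto
    qed (use n K in \<open>auto simp: q_def b_def dens_nonneg\<close>)
    also have "\<dots> = real n * (K * ln (real n) ^ (2 * L) * (real n * q * dens d n) ^ 1 * real n powr (-3/2))"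
      by (simp only: power_one_right b_def mult_ac)
    also have "\<dots> \<le> real n * (K * ln (real n) ^ (2 * L) * ((2 * real d ^ d) ^ 1 * ln (real n) ^ 1) * real n powr (-3/2))"
      unfolding q_def power_mult_distrib[of "2 * real d ^ d", symmetric]
      using n elim K by (intro mult_right_mono mult_left_mono dens_power_le d) auto
    finally show ?case .
  qed
  then show ?thesis
    by (rule perm_prob_tendsto_0) real_asymp
qed

text \<open>Three vertices and two edges leave one factor n up to logarithms, against n^(-3/2): here
  the coefficient of \<open>m_lo\<close> must exceed one half. The edges are distinct, since a
  common edge is the adjacent case.\<close>

lemma prob_low_distance_two_tendsto_0:
  assumes d: "2 \<le> d"
  shows "(\<lambda>n. perm_prob (all_edges d n) (\<lambda>xs. \<exists>u\<in>{1..n}. \<exists>v\<in>{1..n} - {u}. \<exists>w\<in>{1..n} - {u, v}.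
    \<exists>e\<in>star d n u \<inter> star d n w. \<exists>f\<in>star d n v \<inter> star d n w - {e}. {e, f} \<subseteq> set (take (m_hi n) xs) \<and>
    hg_degree (set (take (m_lo d n) xs)) u < L \<and> hg_degree (set (take (m_lo d n) xs)) v < L)) \<longlonglongrightarrow> 0"
proof -
  obtain K where K: "0 \<le> K" and ev:
    "\<forall>\<^sub>F n in sequentially. \<forall>u\<in>{1..n}. \<forall>v\<in>{1..n}. \<forall>J. u \<noteq> v \<longrightarrow>
    J \<subseteq> all_edges d n \<longrightarrow> card J = 2 \<longrightarrow>
    perm_prob (all_edges d n)
      (\<lambda>xs. J \<subseteq> set (take (m_hi n) xs) \<and> hg_degree (set (take (m_lo d n) xs)) u < L \<and>
        hg_degree (set (take (m_lo d n) xs)) v < L) \<le>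
    K * ln (real n) ^ (2 * L) * dens d n ^ 2 * real n powr (-3/2)"
    using ex_two_low_le[OF d] by blast
  from ev have "\<forall>\<^sub>F n in sequentially. perm_prob (all_edges d n) (\<lambda>xs. \<exists>u\<in>{1..n}. \<exists>v\<in>{1..n} - {u}.
    \<exists>w\<in>{1..n} - {u, v}. \<exists>e\<in>star d n u \<inter> star d n w. \<exists>f\<in>star d n v \<inter> star d n w - {e}.
    {e, f} \<subseteq> set (take (m_hi n) xs) \<and>
    hg_degree (set (take (m_lo d n) xs)) u < L \<and> hg_degree (set (take (m_lo d n) xs)) v < L) \<le>
    real n * (K * ln (real n) ^ (2 * L) * ((2 * real d ^ d) ^ 2 * ln (real n) ^ 2) * real n powr (-3/2))"
    using eventually_ge_at_top[of d]
  proof eventually_elim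
    case (elim n)
    define q where "q = real n ^ (d - 2)"
    define b where "b = K * ln (real n) ^ (2 * L) * dens d n ^ 2 * real n powr (-3/2)"
    have n: "0 < real n" "0 \<le> ln (real n)" using elim d by auto
    have "perm_prob (all_edges d n) (\<lambda>xs. \<exists>u\<in>{1..n}. \<exists>v\<in>{1..n} - {u}.
      \<exists>w\<in>{1..n} - {u, v}. \<exists>e\<in>star d n u \<inter> star d n w. \<exists>f\<in>star d n v \<inter> star d n w - {e}.
      {e, f} \<subseteq> set (take (m_hi n) xs) \<and>
      hg_degree (set (take (m_lo d n) xs)) u < L \<and> hg_degree (set (take (m_lo d n) xs)) v < L) \<le>
      real n * (real n * (real n * (q * (q * b))))"
    proof (rule perm_prob_Bex_le; (rule perm_prob_Bex_le)?; (rule perm_prob_Bex_le)?;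
        (rule perm_prob_Bex_le)?; (rule perm_prob_Bex_le)?)
      fix u v w e f assume *: "u \<in> {1..n}" "v \<in> {1..n} - {u}" "w \<in> {1..n} - {u, v}"
        "e \<in> star d n u \<inter> star d n w" "f \<in> star d n v \<inter> star d n w - {e}"
      show "perm_prob (all_edges d n) (\<lambda>xs. {e, f} \<subseteq> set (take (m_hi n) xs) \<and>
          hg_degree (set (take (m_lo d n) xs)) u < L \<and> hg_degree (set (take (m_lo d n) xs)) v < L) \<le> b"
        unfolding b_def using * by (intro elim(1)[rule_format]) (auto simp: star_def card_insert_if)
    next
      fix u v w assume *: "u \<in> {1..n}" "v \<in> {1..n} - {u}" "w \<in> {1..n} - {u, v}"
      then show "real (card (star d n u \<inter> star d n w)) \<le> q"
        unfolding q_def using d by (intro card_star_Int_le) auto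
      have vw: "real (card (star d n v \<inter> star d n w)) \<le> q"
        unfolding q_def using d * by (intro card_star_Int_le) auto
      fix e
      show "real (card (star d n v \<inter> star d n w - {e})) \<le> q"
        using vw card_mono[of "star d n v \<inter> star d n w" "star d n v \<inter> star d n w - {e}"] by fastforce
    next
      fix u v assume *: "u \<in> {1..n}" "v \<in> {1..n} - {u}"
      have "card ({1..n} - {u, v}) \<le> card {1..n}" by (intro card_mono) auto
      then show "real (card ({1..n} - {u, v})) \<le> real n" by simp
    qed (use n K in \<open>auto simp: q_def b_def dens_nonneg\<close>)
    also have "\<dots> = real n * (K * ln (real n) ^ (2 * L) * (real n * q * dens d n) ^ 2 * real n powr (-3/2))"
      by (simp only: power2_eq_square b_def mult_ac)
    also have "\<dots> \<le> real n * (K * ln (real n) ^ (2 * L) * ((2 * real d ^ d) ^ 2 * ln (real n) ^ 2) * real n powr (-3/2))"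
      unfolding q_def power_mult_distrib[of "2 * real d ^ d", symmetric]
      using n elim K by (intro mult_right_mono mult_left_mono dens_power_le d) auto
    finally show ?case .
  qed
  then show ?thesis
    by (rule perm_prob_tendsto_0) real_asymp
qed

section \<open>Existence of isolated vertices\<close>

text \<open>Chebyshev's inequality for the number of \<open>v\<close> with \<open>Q v\<close>,
  written with sums over all permutations. The term \<open>1 / (card V * q)\<close> comes from the
  diagonal of the second moment, and \<open>q2 / q ^ 2 - 1\<close> measures the correlation of two
  different vertices.\<close>

lemma perm_prob_second_moment:
  fixes q q2 :: real
  assumes E: "finite E" and V: "finite V" "V \<noteq> {}" and q: "0 < q" "0 \<le> q2"
    and one: "\<And>v. v \<in> V \<Longrightarrow> perm_prob E (Q v) = q"
    and two: "\<And>u v. u \<in> V \<Longrightarrow> v \<in> V \<Longrightarrow> u \<noteq> v \<Longrightarrow> perm_prob E (\<lambda>xs. Q u xs \<and> Q v xs) = q2"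
  shows "perm_prob E (\<lambda>xs. \<forall>v\<in>V. \<not> Q v xs) \<le> 1 / (card V * q) + q2 / q ^ 2 - 1"
proof -
  define P where "P = permutations_of_set E"
  define M where "M = (fact (card E) :: real)"
  define n where "n = real (card V)"
  define X where "X = (\<lambda>xs. \<Sum>v\<in>V. of_bool (Q v xs) :: real)"
  have fP: "finite P" by (simp add: P_def)
  have M: "0 < M" by (simp add: M_def)
  have n: "0 < n" using V by (simp add: n_def card_gt_0_iff)
  have sum_prob: "(\<Sum>xs\<in>P. of_bool (R xs)) = M * perm_prob E R" for R
  proof -
    have "(\<Sum>xs\<in>P. of_bool (R xs) :: real) = card {xs \<in> P. R xs}"
      using fP by (simp add: of_bool_def sum.If_cases Int_def)
    then show ?thesis using M by (simp add: perm_prob_def P_def M_def)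
  qed
  have "(\<Sum>xs\<in>P. X xs) = (\<Sum>v\<in>V. \<Sum>xs\<in>P. of_bool (Q v xs))"
    unfolding X_def by (rule sum.swap)
  also have "\<dots> = n * (M * q)"
    by (simp add: sum_prob one n_def)
  finally have EX: "(\<Sum>xs\<in>P. X xs) = n * (M * q)" .
  have "(\<Sum>xs\<in>P. (X xs)\<^sup>2) = (\<Sum>xs\<in>P. \<Sum>u\<in>V. \<Sum>v\<in>V. of_bool (Q u xs \<and> Q v xs))"
    by (simp add: X_def power2_eq_square sum_product of_bool_conj)
  also have "\<dots> = (\<Sum>u\<in>V. \<Sum>xs\<in>P. \<Sum>v\<in>V. of_bool (Q u xs \<and> Q v xs))"
    by (rule sum.swap)
  also have "\<dots> = (\<Sum>u\<in>V. \<Sum>v\<in>V. \<Sum>xs\<in>P. of_bool (Q u xs \<and> Q v xs))"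
    by (intro sum.cong refl sum.swap)
  also have "\<dots> = (\<Sum>u\<in>V. \<Sum>v\<in>V. M * perm_prob E (\<lambda>xs. Q u xs \<and> Q v xs))"
    unfolding sum_prob ..
  also have "\<dots> = (\<Sum>u\<in>V. M * q + (n - 1) * (M * q2))"
  proof (intro sum.cong refl)
    fix u assume u: "u \<in> V"
    have "(\<Sum>v\<in>V. M * perm_prob E (\<lambda>xs. Q u xs \<and> Q v xs)) =
        M * perm_prob E (Q u) + (\<Sum>v\<in>V - {u}. M * perm_prob E (\<lambda>xs. Q u xs \<and> Q v xs))"
      using V u by (subst sum.remove[of V u]) auto
    also have "(\<Sum>v\<in>V - {u}. M * perm_prob E (\<lambda>xs. Q u xs \<and> Q v xs)) = (\<Sum>v\<in>V - {u}. M * q2)"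
      using two u by (intro sum.cong) auto
    also have "\<dots> = (n - 1) * (M * q2)"
      using V u n by (simp add: n_def card_Diff_singleton of_nat_diff Suc_le_eq card_gt_0_iff)
    finally show "(\<Sum>v\<in>V. M * perm_prob E (\<lambda>xs. Q u xs \<and> Q v xs)) = M * q + (n - 1) * (M * q2)"
      using one u by simp
  qed
  also have "\<dots> = n * (M * q + (n - 1) * (M * q2))"
    by (simp add: n_def)
  finally have EX2: "(\<Sum>xs\<in>P. (X xs)\<^sup>2) = n * (M * q + (n - 1) * (M * q2))" .
  have "(n * q)\<^sup>2 * (M * perm_prob E (\<lambda>xs. \<forall>v\<in>V. \<not> Q v xs)) =
      (\<Sum>xs\<in>P. (n * q)\<^sup>2 * of_bool (\<forall>v\<in>V. \<not> Q v xs))"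
    unfolding sum_prob[symmetric] sum_distrib_left ..
  \<comment> \<open>Where no \<open>Q v\<close> holds, \<open>X\<close> is 0 and misses its mean
    \<open>n * q\<close> by \<open>n * q\<close>.\<close>
  also have "\<dots> \<le> (\<Sum>xs\<in>P. (X xs - n * q)\<^sup>2)"
  proof (rule sum_mono)
    fix xs
    show "(n * q)\<^sup>2 * of_bool (\<forall>v\<in>V. \<not> Q v xs) \<le> (X xs - n * q)\<^sup>2"
    proof (cases "\<forall>v\<in>V. \<not> Q v xs")
      case True
      then have "X xs = 0" by (simp add: X_def)
      then show ?thesis using True by simp
    next
      case False
      then show ?thesis by auto
    qed
  qed
  also have "\<dots> = (\<Sum>xs\<in>P. (X xs)\<^sup>2 - 2 * (n * q) * X xs + (n * q)\<^sup>2)"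
    by (intro sum.cong) (simp_all add: power2_diff)
  also have "\<dots> = (\<Sum>xs\<in>P. (X xs)\<^sup>2) - 2 * (n * q) * (\<Sum>xs\<in>P. X xs) + card P * (n * q)\<^sup>2"
    by (simp add: sum.distrib sum_subtractf sum_distrib_left)
  also have "real (card P) = M"
    using E by (simp add: P_def M_def)
  also have "(\<Sum>xs\<in>P. (X xs)\<^sup>2) - 2 * (n * q) * (\<Sum>xs\<in>P. X xs) + M * (n * q)\<^sup>2 =
      M * (n * q + n * (n - 1) * q2 - (n * q)\<^sup>2)"
    unfolding EX EX2 by (simp add: algebra_simps power2_eq_square)
  finally have "M * ((n * q)\<^sup>2 * perm_prob E (\<lambda>xs. \<forall>v\<in>V. \<not> Q v xs)) \<le>
      M * (n * q + n * (n - 1) * q2 - (n * q)\<^sup>2)"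
    by (simp only: mult_ac)
  then have le: "(n * q)\<^sup>2 * perm_prob E (\<lambda>xs. \<forall>v\<in>V. \<not> Q v xs) \<le>
      n * q + n * (n - 1) * q2 - (n * q)\<^sup>2"
    using M by simp
  have "n * q + n * (n - 1) * q2 - (n * q)\<^sup>2 \<le> n * q + n\<^sup>2 * q2 - (n * q)\<^sup>2"
      using q n by (simp add: algebra_simps power2_eq_square)
    with le have "perm_prob E (\<lambda>xs. \<forall>v\<in>V. \<not> Q v xs) \<le> (n * q + n\<^sup>2 * q2 - (n * q)\<^sup>2) / (n * q)\<^sup>2"
      using n q by (simp add: pos_le_divide_eq mult.commute)
    also have "\<dots> = 1 / (n * q) + q2 / q\<^sup>2 - 1"
      using n q by (simp add: field_simps power2_eq_square)
    finally show ?thesis by (simp add: n_def)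
qed

text \<open>A converse to \<open>1 - t \<le> exp (- t)\<close>: apply
  \<open>1 + t \<le> exp t\<close> to \<open>t = x / (y - x)\<close> and invert.\<close>

lemma exp_neg_le_quotient:
  fixes x y :: real
  assumes "0 \<le> x" "0 < y - x"
  shows "exp (- (x / (y - x))) \<le> (y - x) / y"
proof -
  have "1 + x / (y - x) \<le> exp (x / (y - x))" by (rule exp_ge_add_one_self)
  moreover have "1 + x / (y - x) = y / (y - x)" using assms by (simp add: field_simps)
  ultimately have "y / (y - x) \<le> exp (x / (y - x))" by simp
  then have "1 / exp (x / (y - x)) \<le> 1 / (y / (y - x))"
    using assms by (intro divide_left_mono) auto
  then show ?thesis by (simp add: exp_minus inverse_eq_divide)
qed

text \<open>The mean number of isolated vertices is at least n^(1/6): a lower exponential bound for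
  the isolation probability turns the exponent 3/4 into 10/9 * 3/4 = 5/6, still below 1. Two
  vertices are nearly uncorrelated because their stars share few edges.\<close>

lemma prob_no_isolated_tendsto_0:
  assumes d: "2 \<le> d"
  shows "(\<lambda>n. perm_prob (all_edges d n)
    (\<lambda>xs. \<forall>v\<in>{1..n}. star d n v \<inter> set (take (m_lo d n) xs) \<noteq> {})) \<longlonglongrightarrow> 0"
proof -
  \<comment> \<open>This bounds \<open>(m + 2 * D) / N\<close>. With one tenth, all denominators
    stay above \<open>9/10 * N\<close>, whence the factor 10/9.\<close>
  have "\<forall>\<^sub>F n in sequentially. dens d n + 2 * real d / real n < 1 / 10"
  proof (rule order_tendstoD)
    have "(\<lambda>n. dens d n + 2 * real d / real n) \<longlonglongrightarrow> 0 + 0"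
      by (intro tendsto_intros dens_tendsto_0 d)
    then show "(\<lambda>n. dens d n + 2 * real d / real n) \<longlonglongrightarrow> 0" by simp
  qed simp
  moreover have "\<forall>\<^sub>F n in sequentially. m_lo d n \<le> m_hi n"
    using d by (intro eventually_m_lo_le_m_hi) auto
  ultimately have "\<forall>\<^sub>F n in sequentially. perm_prob (all_edges d n)
    (\<lambda>xs. \<forall>v\<in>{1..n}. star d n v \<inter> set (take (m_lo d n) xs) \<noteq> {}) \<le>
    real n powr (- 1/6) + (exp (3/2 * real (d - 1) * ln (real n) / (real n - 1)) - 1)"
    using eventually_ge_at_top[of d]
  proof eventually_elim
    case (elim n)
    define m where "m = m_lo d n"
    define N where "N = n choose d"
    define D where "D = (n - 1) choose (d - 1)"
    define D2 where "D2 = (n - 2) choose (d - 2)"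
    define w where "w = 2 * D - D2"
    have n: "2 \<le> n" "0 < real n" "0 \<le> ln (real n)" using elim d by auto
    have N: "0 < real N" using elim by (simp add: N_def)
    have D: "real D = real d * real N / real n"
      using degree_product[of d n] d n by (simp add: N_def D_def field_simps)
    have D2: "(real n - 1) * real D2 = real (d - 1) * real D"
      using degree_product[of "d - 1" "n - 1"] d n by (simp add: D_def D2_def of_nat_diff numeral_2_eq_2)
    \<comment> \<open>Makes the natural subtraction in \<open>w = 2 * D - D2\<close> exact.\<close>
    have D2D: "D2 \<le> D"
    proof -
      have "Suc (n - 2) choose Suc (d - 2) = (n - 2 choose (d - 2)) + (n - 2 choose Suc (d - 2))"
        by (rule binomial_Suc_Suc)
      moreover have "Suc (n - 2) = n - 1" "Suc (d - 2) = d - 1" using n d by auto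
      ultimately show ?thesis by (simp add: D_def D2_def)
    qed
    have small: "real m + 2 * real D \<le> real N / 10"
    proof -
      have "real m \<le> m_hi n" using elim d by (simp add: m_def)
      also have "\<dots> = dens d n * real N" using N by (simp add: dens_def N_def)
      finally have "real m + 2 * real D \<le> (dens d n + 2 * real d / real n) * real N"
        by (simp add: D algebra_simps)
      also have "\<dots> \<le> 1 / 10 * real N"
        using elim by (intro mult_right_mono) auto
      finally show ?thesis by simp
    qed
    have mN: "m \<le> N" using small by linarith
    define q where "q = (\<Prod>i<m. real (N - D - i) / real (N - i))"
    define q2 where "q2 = (\<Prod>i<m. real (N - w - i) / real (N - i))"
    have one: "perm_prob (all_edges d n) (\<lambda>xs. star d n v \<inter> set (take m xs) = {}) = q"
      if "v \<in> {1..n}" for v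
      using perm_prob_avoid[of "all_edges d n" "star d n v" m] mN card_star[OF that, of d] d
      by (auto simp: card_all_edges N_def D_def q_def star_def)
    have two: "perm_prob (all_edges d n) (\<lambda>xs. star d n u \<inter> set (take m xs) = {} \<and>
        star d n v \<inter> set (take m xs) = {}) = q2"
      if "u \<in> {1..n}" "v \<in> {1..n}" "u \<noteq> v" for u v
    proof -
      have "card (star d n u \<union> star d n v) = w"
        using card_star_Un[OF that d] by (simp add: w_def D_def D2_def)
      then have "perm_prob (all_edges d n) (\<lambda>xs. (star d n u \<union> star d n v) \<inter> set (take m xs) = {}) = q2"
        using perm_prob_avoid[of "all_edges d n" "star d n u \<union> star d n v" m] mN
        by (auto simp: card_all_edges N_def q2_def star_def)
      then show ?thesis
        by (simp add: Int_Un_distrib2)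
    qed
    have Dm: "real D * real m / real N \<le> 3/4 * ln (real n)"
    proof -
      have "real D * real m / real N = real d * m_lo d n / real n" using N by (simp add: D m_def)
      also have "\<dots> \<le> real d * (3/4 * (real n / real d) * ln (real n)) / real n"
        using n by (intro divide_right_mono mult_left_mono m_lo_le) auto
      also have "\<dots> = 3/4 * ln (real n)" using d n by simp
      finally show ?thesis .
    qed
    have q_ge: "real n powr (- 5/6) \<le> q"
    proof -
      define c where "c = 10/9 * (real D / real N)"
      have "exp (- c) ^ m = (\<Prod>i<m. exp (- c))" by simp
      also have "\<dots> \<le> q"
        unfolding q_def
      proof (intro prod_mono conjI)
        fix i assume "i \<in> {..<m}"
        then have i: "real i \<le> real m" "D + i \<le> N" using small by auto
        then have y: "9/10 * real N \<le> real (N - i) - real D" using small by linarith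
        then have "real D / (real (N - i) - real D) \<le> real D / (9/10 * real N)"
          using N by (intro divide_left_mono mult_pos_pos) auto
        also have "\<dots> = c" by (simp add: c_def)
        finally have "exp (- c) \<le> exp (- (real D / (real (N - i) - real D)))" by simp
        also have "\<dots> \<le> (real (N - i) - real D) / real (N - i)"
          using y N by (intro exp_neg_le_quotient) auto
        also have "\<dots> = real (N - D - i) / real (N - i)" using i by (simp add: of_nat_diff)
        finally show "exp (- c) \<le> real (N - D - i) / real (N - i)" .
      qed simp
      finally have "exp (- (real m * c)) \<le> q" by (simp add: exp_of_nat_mult[symmetric])
      moreover have "real m * c \<le> 5/6 * ln (real n)"
        using Dm by (simp add: c_def mult_ac)
      then have "exp (- 5/6 * ln (real n)) \<le> exp (- (real m * c))" by simp
      moreover have "exp (- 5/6 * ln (real n)) = real n powr (- 5/6)" using n by (simp add: powr_def)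
      ultimately show ?thesis by linarith
    qed
    moreover have "0 < real n powr (- 5/6)" using n by simp
    ultimately have q: "0 < q" by linarith
    have q2: "0 \<le> q2" by (simp add: q2_def prod_nonneg)
    have q2_le: "q2 \<le> q\<^sup>2 * exp (real m * (2 * real D2 / real N))"
    proof -
      \<comment> \<open>Factor by factor: \<open>(M - 2 * D + D2) * M\<close> exceeds the square of
        \<open>M - D\<close> by at most \<open>D2 * M\<close>. Relative to that square this is at
        most \<open>2 * D2 / N\<close>, since twice the square of 9/10 exceeds 1.\<close>
      have "q2 \<le> (\<Prod>i<m. (real (N - D - i) / real (N - i))\<^sup>2 * exp (2 * real D2 / real N))"
        unfolding q2_def
      proof (intro prod_mono conjI)
        fix i assume "i \<in> {..<m}"
        then have i: "real i \<le> real m" "D + i \<le> N" using small by auto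
        define M where "M = real N - real i"
        have M: "9/10 * real N \<le> M - real D" "M \<le> real N" "0 < M"
          using i small N by (auto simp: M_def)
        have "w + i \<le> N" using small i by (simp add: w_def)
        then have eqs: "real (N - w - i) = M - 2 * real D + real D2" "real (N - D - i) = M - real D"
          "real (N - i) = M"
          using i D2D by (auto simp: M_def w_def of_nat_diff)
        have "real D2 * M * real N \<le> 2 * real D2 * (9/10 * real N)\<^sup>2"
        proof -
          have "real D2 * M * real N \<le> real D2 * real N * real N"
            using M by (intro mult_right_mono mult_left_mono) auto
          also have "\<dots> \<le> 2 * real D2 * (9/10 * real N)\<^sup>2"
            by (simp add: power2_eq_square)
          finally show ?thesis .
        qed
        also have "\<dots> \<le> 2 * real D2 * (M - real D)\<^sup>2"
          using M N by (intro mult_left_mono power_mono) auto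
        finally have "real D2 * M \<le> 2 * real D2 / real N * (M - real D)\<^sup>2"
          using N by (simp add: field_simps)
        moreover have "(M - 2 * real D + real D2) * M \<le> (M - real D)\<^sup>2 + real D2 * M"
          by (simp add: power2_eq_square algebra_simps)
        ultimately have "(M - 2 * real D + real D2) * M \<le> (M - real D)\<^sup>2 * (1 + 2 * real D2 / real N)"
          by (simp add: algebra_simps)
        also have "\<dots> \<le> (M - real D)\<^sup>2 * exp (2 * real D2 / real N)"
          by (intro mult_left_mono exp_ge_add_one_self) auto
        finally have "(M - 2 * real D + real D2) * M / M\<^sup>2 \<le>
            (M - real D)\<^sup>2 * exp (2 * real D2 / real N) / M\<^sup>2"
          by (intro divide_right_mono) auto
        moreover have "(M - 2 * real D + real D2) * M / M\<^sup>2 = (M - 2 * real D + real D2) / M"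
          using M by (simp add: power2_eq_square)
        ultimately show "real (N - w - i) / real (N - i) \<le>
            (real (N - D - i) / real (N - i))\<^sup>2 * exp (2 * real D2 / real N)"
          unfolding eqs power_divide by simp
      qed simp
      also have "\<dots> = q\<^sup>2 * exp (real m * (2 * real D2 / real N))"
        unfolding q_def by (simp add: prod.distrib prod_power_distrib exp_of_nat_mult[symmetric])
      finally show ?thesis .
    qed
    have "perm_prob (all_edges d n) (\<lambda>xs. \<forall>v\<in>{1..n}. \<not> star d n v \<inter> set (take m xs) = {}) \<le>
      1 / (card {1..n} * q) + q2 / q\<^sup>2 - 1"
      using n one two q q2 by (intro perm_prob_second_moment) auto
    also have "\<dots> = 1 / (real n * q) + (q2 / q\<^sup>2 - 1)" by simp
    also have "\<dots> \<le> real n powr (- 1/6) + (exp (3/2 * real (d - 1) * ln (real n) / (real n - 1)) - 1)"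
    proof (intro add_mono diff_mono order_refl)
      have "real n powr (1/6) = real n powr 1 * real n powr (- 5/6)"
        unfolding powr_add[symmetric] by simp
      also have "\<dots> \<le> real n * q" using q_ge n by (simp add: mult_left_mono)
      finally have "1 / (real n * q) \<le> 1 / real n powr (1/6)"
        using n q by (intro divide_left_mono) auto
      then show "1 / (real n * q) \<le> real n powr (- 1/6)" by (simp add: powr_minus_divide)
      have "q2 / q\<^sup>2 \<le> exp (real m * (2 * real D2 / real N))"
        using q2_le q by (simp add: pos_divide_le_eq mult.commute)
      also have "real D2 = real (d - 1) / (real n - 1) * real D" using D2 n by (simp add: field_simps)
      then have "real m * (2 * real D2 / real N) = 2 * (real (d - 1) / (real n - 1)) * (real D * real m / real N)"
        by simp
      also have "\<dots> \<le> 2 * (real (d - 1) / (real n - 1)) * (3/4 * ln (real n))"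
        using Dm n by (intro mult_left_mono) auto
      also have "\<dots> = 3/2 * real (d - 1) * ln (real n) / (real n - 1)"
      proof -
        have "2 * (x / y) * (3/4 * z) = 3/2 * x * z / y" for x y z :: real
          by (cases "y = 0") (auto simp: field_simps)
        then show ?thesis .
      qed
      finally show "q2 / q\<^sup>2 \<le> exp (3/2 * real (d - 1) * ln (real n) / (real n - 1))"
        by simp
    qed
    finally show ?case by (simp add: m_def)
  qed
  then show ?thesis
    by (rule perm_prob_tendsto_0) real_asymp
qed

section \<open>Sparsity and expansion\<close>

text \<open>\<open>k ^ k / fact k\<close> is a single term of the series of
  \<open>exp k\<close>.\<close>

lemma binomial_le_exp_power:
  assumes "1 \<le> k"
  shows "real (n choose k) \<le> (exp 1 * real n / real k) ^ k"
proof -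
  have "real k ^ k / fact k \<le> exp (real k)"
  proof -
    have s: "(\<lambda>i. real k ^ i /\<^sub>R fact i) sums exp (real k)" by (rule exp_converges)
    have "(\<Sum>i\<in>{k}. real k ^ i /\<^sub>R fact i) \<le> (\<Sum>i. real k ^ i /\<^sub>R fact i)"
      by (intro sum_le_suminf sums_summable[OF s]) auto
    also have "\<dots> = exp (real k)" by (rule sums_unique[OF s, symmetric])
    finally have "(\<Sum>i\<in>{k}. real k ^ i /\<^sub>R fact i) \<le> exp (real k)" .
    then show ?thesis by (simp add: divide_inverse mult.commute)
  qed
  then have k: "real k ^ k \<le> exp 1 ^ k * fact k"
    by (simp add: field_simps exp_of_nat_mult[symmetric])
  have "real ((n choose k) * fact k) \<le> real (n ^ k)"
    by (intro of_nat_mono binomial_fact_pow)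
  then have "real (n choose k) * fact k \<le> real n ^ k" by simp
  then have "real (n choose k) * fact k * real k ^ k \<le> real n ^ k * (exp 1 ^ k * fact k)"
    using k by (intro mult_mono) auto
  then have "real (n choose k) * real k ^ k \<le> (exp 1 * real n) ^ k"
    by (simp add: power_mult_distrib mult_ac)
  then show ?thesis using assms by (simp add: power_divide pos_le_divide_eq)
qed

text \<open>There are at most (e n / a)^a sets and (e a^d / (2 a))^(2 a) families of 2 a edges
  inside one of them, each present with probability at most \<open>dens d n ^ (2 * a)\<close>. The
  a-th root of the product is at most C (ln n)^2 (a / n)^3, using d \<ge> 3, and hence at most C /
  ln n; so the sizes sum like a geometric series.\<close>

lemma prob_dense_tendsto_0:
  assumes d: "3 \<le> d"
  shows "(\<lambda>n. perm_prob (all_edges d n) (\<lambda>xs. \<exists>a\<in>{1..nat \<lfloor>real n / ln (real n)\<rfloor>}.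
    \<exists>A\<in>{A. A \<subseteq> {1..n} \<and> card A = a}. \<exists>J\<in>{J. J \<subseteq> {e. e \<subseteq> A \<and> card e = d} \<and> card J = 2 * a}.
    J \<subseteq> set (take (m_hi n) xs))) \<longlonglongrightarrow> 0"
proof -
  define c where "c = 2 * real d ^ d"
  \<comment> \<open>One factor \<open>exp 1\<close> comes from choosing the set, the square of
    \<open>exp 1 / 2\<close> from choosing its edges, and the square of \<open>c\<close> from the
    density.\<close>
  define C where "C = exp 1 ^ 3 * c\<^sup>2 / 4"
  have C: "0 < C" using d by (simp add: C_def c_def)
  have "\<forall>\<^sub>F n::nat in sequentially. 1 \<le> ln (real n)"
    by real_asymp
  moreover have "\<forall>\<^sub>F n::nat in sequentially. C / ln (real n) \<le> 1 / 2"
    using C by real_asymp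
  moreover have "\<forall>\<^sub>F n in sequentially. m_hi n \<le> n choose d"
    using d by (intro eventually_m_hi_le) auto
  ultimately have "\<forall>\<^sub>F n in sequentially. perm_prob (all_edges d n)
    (\<lambda>xs. \<exists>a\<in>{1..nat \<lfloor>real n / ln (real n)\<rfloor>}. \<exists>A\<in>{A. A \<subseteq> {1..n} \<and> card A = a}.
      \<exists>J\<in>{J. J \<subseteq> {e. e \<subseteq> A \<and> card e = d} \<and> card J = 2 * a}. J \<subseteq> set (take (m_hi n) xs)) \<le>
    2 * (C / ln (real n))"
    using eventually_ge_at_top[of d]
  proof eventually_elim
    case (elim n)
    define l where "l = ln (real n)"
    define y where "y = dens d n"
    define r where "r = C / l"
    define x where "x = real n / l"
    have n: "0 < real n" "1 \<le> l" "d \<le> n" using elim d by (auto simp: l_def)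
    have r: "0 \<le> r" "r \<le> 1 / 2" using elim C n by (auto simp: r_def l_def)
    have y: "0 \<le> y" by (simp add: y_def dens_nonneg)
    have each: "perm_prob (all_edges d n) (\<lambda>xs. \<exists>A\<in>{A. A \<subseteq> {1..n} \<and> card A = a}.
        \<exists>J\<in>{J. J \<subseteq> {e. e \<subseteq> A \<and> card e = d} \<and> card J = 2 * a}. J \<subseteq> set (take (m_hi n) xs)) \<le> r ^ a"
      if a: "a \<in> {1..nat \<lfloor>x\<rfloor>}" for a
    proof -
      have a1: "1 \<le> a" and ax: "real a \<le> x" using a n by (auto simp: x_def le_nat_floor) linarith
      then have al: "real a * l \<le> real n" using n by (simp add: x_def field_simps)
      have "real a * 1 \<le> real a * l" using n by (intro mult_left_mono) auto
      then have an: "real a \<le> real n" using al by linarith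
      have "perm_prob (all_edges d n) (\<lambda>xs. \<exists>A\<in>{A. A \<subseteq> {1..n} \<and> card A = a}.
        \<exists>J\<in>{J. J \<subseteq> {e. e \<subseteq> A \<and> card e = d} \<and> card J = 2 * a}. J \<subseteq> set (take (m_hi n) xs)) \<le>
        (exp 1 * real n / real a) ^ a *
        ((exp 1 * real a ^ d / real (2 * a)) ^ (2 * a) * y ^ (2 * a))"
      proof (rule perm_prob_Bex_le; (rule perm_prob_Bex_le)?)
        fix A J assume A: "A \<in> {A. A \<subseteq> {1..n} \<and> card A = a}"
          and J: "J \<in> {J. J \<subseteq> {e. e \<subseteq> A \<and> card e = d} \<and> card J = 2 * a}"
        have "J \<subseteq> all_edges d n" using A J by (auto simp: all_edges_def)
        then have "perm_prob (all_edges d n) (\<lambda>xs. J \<subseteq> set (take (m_hi n) xs)) \<le> y ^ card J"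
          unfolding y_def dens_def card_all_edges[symmetric] using elim
          by (intro perm_prob_include_le) (auto simp: card_all_edges)
        then show "perm_prob (all_edges d n) (\<lambda>xs. J \<subseteq> set (take (m_hi n) xs)) \<le> y ^ (2 * a)"
          using J by simp
      next
        fix A assume A: "A \<in> {A. A \<subseteq> {1..n} \<and> card A = a}"
        then have fA: "finite A" using finite_subset by auto
        then have fin: "finite {e. e \<subseteq> A \<and> card e = d}" by simp
        then show "finite {J. J \<subseteq> {e. e \<subseteq> A \<and> card e = d} \<and> card J = 2 * a}" by simp
        have "card {J. J \<subseteq> {e. e \<subseteq> A \<and> card e = d} \<and> card J = 2 * a} = (a choose d) choose (2 * a)"
          using n_subsets[OF fin] n_subsets[OF fA, of d] A by simp
        also have "real \<dots> \<le> (exp 1 * real (a choose d) / real (2 * a)) ^ (2 * a)"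
          using a1 by (intro binomial_le_exp_power) auto
        also have "\<dots> \<le> (exp 1 * real a ^ d / real (2 * a)) ^ (2 * a)"
          by (intro power_mono divide_right_mono mult_left_mono binomial_le_power) auto
        finally show "real (card {J. J \<subseteq> {e. e \<subseteq> A \<and> card e = d} \<and> card J = 2 * a}) \<le>
          (exp 1 * real a ^ d / real (2 * a)) ^ (2 * a)" .
      next
        have "card {A. A \<subseteq> {1..n} \<and> card A = a} = n choose a"
          using n_subsets[of "{1..n}" a] by simp
        then show "real (card {A. A \<subseteq> {1..n} \<and> card A = a}) \<le> (exp 1 * real n / real a) ^ a"
          using binomial_le_exp_power[OF a1, of n] by simp
      qed (use y in auto)
      also have "\<dots> = (exp 1 * real n / real a * (exp 1 * real a ^ d / real (2 * a) * y)\<^sup>2) ^ a"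
        by (simp only: power_mult power_mult_distrib)
      also have "\<dots> \<le> r ^ a"
      proof (intro power_mono)
        have eq: "real a ^ d / real (2 * a) = real a ^ (d - 1) / 2"
          using a1 d by (simp add: power_diff[of "real a" 1 d, simplified])
        have "exp 1 * real a ^ d / real (2 * a) * y = exp 1 * (real a ^ d / real (2 * a)) * y"
          by (simp only: times_divide_eq_right)
        also have "\<dots> = exp 1 / 2 * (real a ^ (d - 1) * y)"
          unfolding eq by simp
        also have "\<dots> = exp 1 / 2 * ((real a / real n) ^ (d - 1) * (real n ^ (d - 1) * y))"
          using n by (simp add: power_divide)
        also have "\<dots> \<le> exp 1 / 2 * ((real a / real n) ^ 2 * (c * l))"
        proof (rule mult_left_mono; (rule mult_mono)?)
          show "(real a / real n) ^ (d - 1) \<le> (real a / real n) ^ 2"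
            using d an n by (intro power_decreasing) (auto simp: divide_le_eq_1)
          show "real n ^ (d - 1) * y \<le> c * l"
            unfolding y_def c_def l_def using n(3) d by (intro dens_le) simp_all
        qed (use y in simp_all)
        finally have "(exp 1 * real a ^ d / real (2 * a) * y)\<^sup>2 \<le>
            (exp 1 / 2 * ((real a / real n) ^ 2 * (c * l)))\<^sup>2"
          using y by (intro power_mono) auto
        then have "exp 1 * real n / real a * (exp 1 * real a ^ d / real (2 * a) * y)\<^sup>2 \<le>
            exp 1 * real n / real a * (exp 1 / 2 * ((real a / real n) ^ 2 * (c * l)))\<^sup>2"
          by (intro mult_left_mono) auto
        also have "\<dots> = C * l\<^sup>2 * (real a / real n) ^ 3"
          using n a1 by (simp add: C_def field_simps power2_eq_square power3_eq_cube)
        also have "\<dots> \<le> C * l\<^sup>2 * (1 / l) ^ 3"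
          using al n C by (intro mult_left_mono power_mono) (auto simp: field_simps)
        also have "\<dots> = r" using n by (simp add: r_def field_simps power2_eq_square power3_eq_cube)
        finally show "exp 1 * real n / real a * (exp 1 * real a ^ d / real (2 * a) * y)\<^sup>2 \<le> r" .
      qed auto
      finally show ?thesis .
    qed
    have "perm_prob (all_edges d n)
        (\<lambda>xs. \<exists>a\<in>{1..nat \<lfloor>x\<rfloor>}. \<exists>A\<in>{A. A \<subseteq> {1..n} \<and> card A = a}.
          \<exists>J\<in>{J. J \<subseteq> {e. e \<subseteq> A \<and> card e = d} \<and> card J = 2 * a}. J \<subseteq> set (take (m_hi n) xs)) \<le>
      (\<Sum>a\<in>{1..nat \<lfloor>x\<rfloor>}. perm_prob (all_edges d n) (\<lambda>xs. \<exists>A\<in>{A. A \<subseteq> {1..n} \<and> card A = a}.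
          \<exists>J\<in>{J. J \<subseteq> {e. e \<subseteq> A \<and> card e = d} \<and> card J = 2 * a}. J \<subseteq> set (take (m_hi n) xs)))"
      by (rule perm_prob_Bex) simp
    also have "\<dots> \<le> (\<Sum>a\<in>{1..nat \<lfloor>x\<rfloor>}. r ^ a)"
      by (intro sum_mono each)
    also have "\<dots> \<le> 2 * r"
    proof -
      \<comment> \<open>The subtracted term makes the bound inductive; \<open>r \<le> 1 / 2\<close>
        absorbs each new term.\<close>
      have geom: "(\<Sum>a\<in>{1..M}. r ^ a) \<le> 2 * r - 2 * r ^ Suc M" for M
      proof (induction M)
        case 0
        then show ?case by simp
      next
        case (Suc M)
        have "(2 * r) * r ^ Suc M \<le> 1 * r ^ Suc M"
          using r by (intro mult_right_mono) auto
        then have "2 * r ^ Suc (Suc M) \<le> r ^ Suc M" by simp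
        moreover have "(\<Sum>a\<in>{1..Suc M}. r ^ a) = (\<Sum>a\<in>{1..M}. r ^ a) + r ^ Suc M" by simp
        ultimately show ?case using Suc by linarith
      qed
      have "0 \<le> r ^ Suc (nat \<lfloor>x\<rfloor>)" using r(1) by (rule zero_le_power)
      then show ?thesis using geom[of "nat \<lfloor>x\<rfloor>"] by linarith
    qed
    finally show ?case by (simp add: x_def l_def r_def)
  qed
  then show ?thesis
    by (rule perm_prob_tendsto_0) real_asymp
qed

text \<open>It suffices to count edges with exactly one vertex in \<open>A\<close> and the other
  \<open>d - 1\<close> outside \<open>A\<close> and \<open>S\<close>; such an edge determines its
  vertex in \<open>A\<close> and the rest.\<close>

lemma card_crossing_edges_ge:
  assumes A: "A \<subseteq> {1..n} - S" and S: "S \<subseteq> {1..n}" and d: "2 \<le> d"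
  shows "card A * (card ({1..n} - S - A) choose (d - 1)) \<le>
    card {e \<in> all_edges d n. e \<inter> S = {} \<and> e \<inter> A \<noteq> {} \<and> \<not> e \<subseteq> A}"
proof -
  define B where "B = {1..n} - S - A"
  define X where "X = {X. X \<subseteq> B \<and> card X = d - 1}"
  have fin: "finite A" "finite B" using A by (auto simp: B_def intro: finite_subset)
  have "inj_on (\<lambda>(a, X). insert a X) (A \<times> X)"
  proof (rule inj_onI, clarify)
    fix a X1 b X2 assume *: "a \<in> A" "X1 \<in> X" "b \<in> A" "X2 \<in> X" "insert a X1 = insert b X2"
    then have "X1 \<inter> A = {}" "X2 \<inter> A = {}" by (auto simp: X_def B_def)
    then have "insert a X1 \<inter> A = {a}" "insert b X2 \<inter> A = {b}" using * by auto
    then have "a = b" using *(5) by auto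
    moreover have "a \<notin> X1" "b \<notin> X2" using \<open>X1 \<inter> A = {}\<close> \<open>X2 \<inter> A = {}\<close> * by auto
    ultimately show "a = b \<and> X1 = X2" using *(5) by (auto simp: insert_ident)
  qed
  then have "card ((\<lambda>(a, X). insert a X) ` (A \<times> X)) = card A * card X"
    by (simp add: card_image card_cartesian_product)
  moreover have "card X = card B choose (d - 1)"
    unfolding X_def using n_subsets[OF fin(2)] by simp
  moreover have "(\<lambda>(a, X). insert a X) ` (A \<times> X) \<subseteq>
    {e \<in> all_edges d n. e \<inter> S = {} \<and> e \<inter> A \<noteq> {} \<and> \<not> e \<subseteq> A}"
  proof clarify
    fix a Y assume a: "a \<in> A" and Y: "Y \<in> X"
    then have "a \<notin> Y" "finite Y" "Y \<noteq> {}" "Y \<inter> A = {}"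
      using fin d by (auto simp: X_def B_def intro: finite_subset)
    then show "insert a Y \<in> all_edges d n \<and> insert a Y \<inter> S = {} \<and> insert a Y \<inter> A \<noteq> {} \<and> \<not> insert a Y \<subseteq> A"
      using a Y A d by (auto simp: all_edges_def X_def B_def)
  qed
  then have "card ((\<lambda>(a, X). insert a X) ` (A \<times> X)) \<le>
    card {e \<in> all_edges d n. e \<inter> S = {} \<and> e \<inter> A \<noteq> {} \<and> \<not> e \<subseteq> A}"
    by (intro card_mono) auto
  ultimately show ?thesis by (simp add: B_def)
qed

text \<open>For a > n / ln n there are at most (e ln n)^a sets of size a, and missing all crossing
  edges costs exp (- g a ln n). As g ln n beats ln ln n however small \<open>g\<close> is, the
  product is at most exp (- a). For much smaller sets ln (n / a) would compete with g ln n, so they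
  are left to sparsity.\<close>

lemma prob_separated_tendsto_0:
  assumes d: "2 \<le> d" and k: "1 \<le> k"
  shows "(\<lambda>n. perm_prob (all_edges d n) (\<lambda>xs. \<exists>S\<in>{S. S \<subseteq> {1..n} \<and> card S = k - 1}.
    \<exists>a\<in>{a\<in>{1..n}. real n / ln (real n) < real a \<and> 2 * a \<le> n - (k - 1)}.
    \<exists>A\<in>{A. A \<subseteq> {1..n} - S \<and> card A = a}.
    {e \<in> all_edges d n. e \<inter> S = {} \<and> e \<inter> A \<noteq> {} \<and> \<not> e \<subseteq> A} \<inter> set (take (m_lo d n) xs) = {})) \<longlonglongrightarrow> 0"
proof -
  \<comment> \<open>With at least n / 3 vertices outside, \<open>b choose (d - 1)\<close> is at
    least \<open>(n / (3 * d)) ^ (d - 1)\<close>. The factor \<open>1 / (2 * d)\<close> in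
    \<open>g\<close> comes from the bound n ln n / (2 d) below \<open>m_lo\<close>.\<close>
  define g0 where "g0 = (1 / (3 * real d)) ^ (d - 1)"
  define g where "g = g0 / (2 * real d)"
  have g: "0 < g" "0 < g0" using d by (simp_all add: g_def g0_def)
  have "\<forall>\<^sub>F n::nat in sequentially. 1 \<le> ln (real n)"
    by real_asymp
  moreover have "\<forall>\<^sub>F n::nat in sequentially. 1 + ln (ln (real n)) + 1 \<le> g * ln (real n)"
    using g by real_asymp
  moreover have "\<forall>\<^sub>F n::nat in sequentially. 1 / 2 * (real n / real d) * ln (real n) \<le>
      3/4 * (real n / real d) * ln (real n) - 1"
    using d by real_asymp
  moreover have "\<forall>\<^sub>F n in sequentially. m_hi n \<le> n choose d"
    using d by (intro eventually_m_hi_le) auto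
  moreover have "\<forall>\<^sub>F n in sequentially. m_lo d n \<le> m_hi n"
    using d by (intro eventually_m_lo_le_m_hi) auto
  ultimately have "\<forall>\<^sub>F n in sequentially. perm_prob (all_edges d n)
    (\<lambda>xs. \<exists>S\<in>{S. S \<subseteq> {1..n} \<and> card S = k - 1}.
    \<exists>a\<in>{a\<in>{1..n}. real n / ln (real n) < real a \<and> 2 * a \<le> n - (k - 1)}.
    \<exists>A\<in>{A. A \<subseteq> {1..n} - S \<and> card A = a}.
    {e \<in> all_edges d n. e \<inter> S = {} \<and> e \<inter> A \<noteq> {} \<and> \<not> e \<subseteq> A} \<inter> set (take (m_lo d n) xs) = {}) \<le>
    real n ^ (k - 1) * (real n * exp (- (real n / ln (real n))))"
    using eventually_ge_at_top[of "3 * (d + k)"]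
  proof eventually_elim
    case (elim n)
    define l where "l = ln (real n)"
    define N where "N = real (n choose d)"
    have n: "0 < real n" "1 \<le> l" "d \<le> n" "3 * d + 3 * k \<le> n" using elim d by (auto simp: l_def)
    have N: "0 < N" using n by (simp add: N_def)
    have "perm_prob (all_edges d n) (\<lambda>xs. \<exists>A\<in>{A. A \<subseteq> {1..n} - S \<and> card A = a}.
        {e \<in> all_edges d n. e \<inter> S = {} \<and> e \<inter> A \<noteq> {} \<and> \<not> e \<subseteq> A} \<inter> set (take (m_lo d n) xs) = {}) \<le>
      exp (- (real n / l))"
      if S: "S \<subseteq> {1..n}" "card S = k - 1" and a: "1 \<le> a" "real n / l < real a" "2 * a \<le> n - (k - 1)"
      for S a
    proof -
      have "perm_prob (all_edges d n) (\<lambda>xs. \<exists>A\<in>{A. A \<subseteq> {1..n} - S \<and> card A = a}.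
        {e \<in> all_edges d n. e \<inter> S = {} \<and> e \<inter> A \<noteq> {} \<and> \<not> e \<subseteq> A} \<inter> set (take (m_lo d n) xs) = {}) \<le>
        (exp 1 * l) ^ a * exp (- (real a * g * l))"
      proof (rule perm_prob_Bex_le)
        have "card {A. A \<subseteq> {1..n} - S \<and> card A = a} = card ({1..n} - S) choose a"
          by (intro n_subsets) simp
        also have "\<dots> \<le> n choose a"
          using card_mono[of "{1..n}" "{1..n} - S"] by (intro binomial_right_mono) auto
        finally have "real (card {A. A \<subseteq> {1..n} - S \<and> card A = a}) \<le> real (n choose a)" by simp
        also have "\<dots> \<le> (exp 1 * real n / real a) ^ a" by (rule binomial_le_exp_power[OF a(1)])
        also have "\<dots> \<le> (exp 1 * l) ^ a"
          using a n by (intro power_mono) (auto simp: field_simps)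
        finally show "real (card {A. A \<subseteq> {1..n} - S \<and> card A = a}) \<le> (exp 1 * l) ^ a" .
      next
        fix A assume A: "A \<in> {A. A \<subseteq> {1..n} - S \<and> card A = a}"
        define F where "F = {e \<in> all_edges d n. e \<inter> S = {} \<and> e \<inter> A \<noteq> {} \<and> \<not> e \<subseteq> A}"
        define b where "b = card ({1..n} - S - A)"
        have fS: "finite S" using S finite_subset by auto
        have fA: "finite A" using A finite_subset by auto
        have "card ({1..n} - S) = n - (k - 1)" using S fS by (simp add: card_Diff_subset)
        then have "b = n - (k - 1) - a"
          unfolding b_def using A fA by (subst card_Diff_subset) auto
        \<comment> \<open>Half of the undeleted vertices lie outside \<open>A\<close>, and
          \<open>3 * (d + k) \<le> n\<close> makes the \<open>k - 1\<close> deleted ones negligible;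
          this leaves a third of all vertices.\<close>
        then have "n - (k - 1) \<le> 2 * b" using a(3) by linarith
        moreover have "2 * n \<le> 3 * (n - (k - 1))" using n(4) by arith
        ultimately have "n \<le> 3 * b" by linarith
        then have b: "real n / 3 \<le> real b" "d \<le> b" using n(4) by linarith+
        have F_ge: "real a * g0 / real n * N \<le> real (card F)"
        proof -
          have "N \<le> real n ^ d" unfolding N_def by (rule binomial_le_power)
          also have "\<dots> = real n * real n ^ (d - 1)" using d by (simp add: power_eq_if)
          finally have "real a * g0 / real n * N \<le> real a * g0 / real n * (real n * real n ^ (d - 1))"
            using g by (intro mult_left_mono) auto
          also have "\<dots> = real a * (real n / 3 / real d) ^ (d - 1)"
            using n by (simp add: g0_def power_divide power_mult_distrib)
          also have "\<dots> \<le> real a * (real b / real (d - 1)) ^ (d - 1)"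
            using b d n by (intro mult_left_mono power_mono frac_le) auto
          also have "\<dots> \<le> real a * real (b choose (d - 1))"
            using b by (intro mult_left_mono binomial_ge_n_over_k_pow_k) auto
          also have "\<dots> = real (card A * (b choose (d - 1)))" using A by simp
          also have "\<dots> \<le> real (card F)"
            unfolding F_def b_def using A S d by (intro of_nat_mono card_crossing_edges_ge) auto
          finally show ?thesis .
        qed
        have FN: "card F \<le> n choose d"
          unfolding card_all_edges[symmetric] F_def by (intro card_mono) auto
        have "perm_prob (all_edges d n) (\<lambda>xs. F \<inter> set (take (m_lo d n) xs) = {}) \<le>
            (1 - card F / N) ^ m_lo d n"
          unfolding N_def card_all_edges[symmetric] using elim
          by (intro perm_prob_avoid_le) (auto simp: F_def card_all_edges)
        also have "\<dots> \<le> exp (- (card F / N)) ^ m_lo d n"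
          using FN N exp_ge_add_one_self[of "- (card F / N)"]
          by (intro power_mono) (auto simp: N_def divide_le_eq_1)
        also have "\<dots> = exp (- (real (m_lo d n) * (card F / N)))"
          by (simp add: exp_of_nat_mult[symmetric])
        also have "\<dots> \<le> exp (- (real a * g * l))"
        proof -
          have "real a * g * l = 1 / 2 * (real n / real d) * l * (real a * g0 / real n)"
            using n by (simp add: g_def)
          also have "\<dots> \<le> real (m_lo d n) * (card F / N)"
          proof (intro mult_mono)
            show "1 / 2 * (real n / real d) * l \<le> real (m_lo d n)"
              using elim m_lo_ge[of n d] by (simp add: l_def)
            show "real a * g0 / real n \<le> card F / N"
              using F_ge N by (simp add: pos_le_divide_eq)
          qed (use g n in auto)
          finally show ?thesis by simp
        qed
        finally show "perm_prob (all_edges d n) (\<lambda>xs. {e \<in> all_edges d n. e \<inter> S = {} \<and> e \<inter> A \<noteq> {} \<and> \<not> e \<subseteq> A}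
            \<inter> set (take (m_lo d n) xs) = {}) \<le> exp (- (real a * g * l))"
          by (simp add: F_def)
      qed auto
      also have "\<dots> = exp (real a * (1 + ln l - g * l))"
      proof -
        have "exp 1 * l = exp (1 + ln l)" using n by (simp add: exp_add)
        then have "(exp 1 * l) ^ a = exp (real a * (1 + ln l))" by (simp only: exp_of_nat_mult)
        then show ?thesis by (simp add: algebra_simps flip: exp_add)
      qed
      also have "\<dots> \<le> exp (real a * (- 1))"
      proof -
        have "1 + ln l - g * l \<le> - 1" using elim by (simp add: l_def)
        then show ?thesis by (intro iffD2[OF exp_le_cancel_iff] mult_left_mono) auto
      qed
      also have "\<dots> \<le> exp (- (real n / l))" using a(2) by simp
      finally show ?thesis .
    qed
    note each = this
    show ?case
    proof (rule perm_prob_Bex_le; (rule perm_prob_Bex_le)?)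
      fix S a assume "S \<in> {S. S \<subseteq> {1..n} \<and> card S = k - 1}"
        "a \<in> {a\<in>{1..n}. real n / ln (real n) < real a \<and> 2 * a \<le> n - (k - 1)}"
      then show "perm_prob (all_edges d n) (\<lambda>xs. \<exists>A\<in>{A. A \<subseteq> {1..n} - S \<and> card A = a}.
        {e \<in> all_edges d n. e \<inter> S = {} \<and> e \<inter> A \<noteq> {} \<and> \<not> e \<subseteq> A} \<inter> set (take (m_lo d n) xs) = {}) \<le>
        exp (- (real n / ln (real n)))"
        using each[of S a] by (simp add: l_def)
    next
      have "card {a\<in>{1..n}. real n / ln (real n) < real a \<and> 2 * a \<le> n - (k - 1)} \<le> card {1..n}"
        by (intro card_mono) auto
      then show "real (card {a\<in>{1..n}. real n / ln (real n) < real a \<and> 2 * a \<le> n - (k - 1)}) \<le> real n"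
        by simp
    next
      show "real (card {S. S \<subseteq> {1..n} \<and> card S = k - 1}) \<le> real n ^ (k - 1)"
        using n_subsets[of "{1..n}" "k - 1"] binomial_le_power[of n "k - 1"] by simp
    qed auto
  qed
  then show ?thesis
    by (rule perm_prob_tendsto_0) real_asymp
qed

section \<open>Hitting times\<close>

text \<open>The least time with \<open>P\<close> lies after \<open>r\<close> and not after
  \<open>m\<close>, hence in the window where \<open>P\<close> yields \<open>Q\<close>. Since
  \<open>Q\<close> always yields \<open>P\<close>, it cannot occur earlier. The bound on
  \<open>m\<close> keeps this time within the range of \<open>first_time\<close>.\<close>

lemma first_time_eqI:
  assumes "m \<le> length es"
    and "P (hypergraph_at es m)" "\<And>j. j \<le> r \<Longrightarrow> \<not> P (hypergraph_at es j)"
    and "\<And>j. r \<le> j \<Longrightarrow> j \<le> m \<Longrightarrow> P (hypergraph_at es j) \<Longrightarrow> Q (hypergraph_at es j)"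
    and "\<And>j. Q (hypergraph_at es j) \<Longrightarrow> P (hypergraph_at es j)"
  shows "first_time es P = first_time es Q"
proof -
  define j where "j = (LEAST j. P (hypergraph_at es j))"
  have Pj: "P (hypergraph_at es j)" unfolding j_def using assms(2) by (rule LeastI)
  have least: "j \<le> i" if "P (hypergraph_at es i)" for i unfolding j_def using that by (rule Least_le)
  have "j \<le> m" using least assms(2) .
  moreover have "r \<le> j" using assms(3)[of j] Pj by (cases "j \<le> r") auto
  ultimately have Qj: "Q (hypergraph_at es j)" using assms(4) Pj by blast
  have eq: "first_time es R = enat j" if "R (hypergraph_at es j)" "\<And>i. R (hypergraph_at es i) \<Longrightarrow> j \<le> i" for R
    unfolding first_time_def using that \<open>j \<le> m\<close> assms(1)
    by (intro antisym Inf_lower Inf_greatest) auto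
  show ?thesis using eq[of P] eq[of Q] Pj Qj least assms(5) by metis
qed

text \<open>Translates the exceptional events, whose nested quantifiers suit union bounds, into the
  cardinality conditions of the deterministic criterion, for one fixed trajectory.\<close>

lemma k_connected_process:
  fixes d k n :: nat
  defines "L \<equiv> 3 * d + 2 * k"
  assumes dk: "3 \<le> d" "1 \<le> k" and n: "k < n" and m: "m_lo d n \<le> j" "j \<le> m_hi n"
    and xs: "xs \<in> permutations_of_set (all_edges d n)"
    and deg: "\<And>v. v \<in> {1..n} \<Longrightarrow> k \<le> hg_degree (set (take j xs)) v"
    and codegree: "\<not> (\<exists>u\<in>{1..n}. \<exists>w\<in>{1..n} - {u}.
      \<exists>e\<in>star d n u \<inter> star d n w. \<exists>f\<in>star d n u \<inter> star d n w - {e}.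
      \<exists>g\<in>star d n u \<inter> star d n w - {e, f}. {e, f, g} \<subseteq> set (take (m_hi n) xs))"
    and low_codegree: "\<not> (\<exists>u\<in>{1..n}. \<exists>w\<in>{1..n} - {u}.
      \<exists>e\<in>star d n u \<inter> star d n w. \<exists>f\<in>star d n u \<inter> star d n w - {e}.
      {e, f} \<subseteq> set (take (m_hi n) xs) \<and> hg_degree (set (take (m_lo d n) xs)) u < L)"
    and low_adjacent: "\<not> (\<exists>u\<in>{1..n}. \<exists>v\<in>{1..n} - {u}.
      \<exists>e\<in>star d n u \<inter> star d n v. {e} \<subseteq> set (take (m_hi n) xs) \<and>
      hg_degree (set (take (m_lo d n) xs)) u < L \<and> hg_degree (set (take (m_lo d n) xs)) v < L)"
    and low_distance_two: "\<not> (\<exists>u\<in>{1..n}. \<exists>v\<in>{1..n} - {u}. \<exists>w\<in>{1..n} - {u, v}.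
      \<exists>e\<in>star d n u \<inter> star d n w. \<exists>f\<in>star d n v \<inter> star d n w - {e}. {e, f} \<subseteq> set (take (m_hi n) xs) \<and>
      hg_degree (set (take (m_lo d n) xs)) u < L \<and> hg_degree (set (take (m_lo d n) xs)) v < L)"
    and dense: "\<not> (\<exists>a\<in>{1..nat \<lfloor>real n / ln (real n)\<rfloor>}.
      \<exists>A\<in>{A. A \<subseteq> {1..n} \<and> card A = a}. \<exists>J\<in>{J. J \<subseteq> {e. e \<subseteq> A \<and> card e = d} \<and> card J = 2 * a}.
      J \<subseteq> set (take (m_hi n) xs))"
    and separated: "\<not> (\<exists>S\<in>{S. S \<subseteq> {1..n} \<and> card S = k - 1}.
      \<exists>a\<in>{a\<in>{1..n}. real n / ln (real n) < real a \<and> 2 * a \<le> n - (k - 1)}.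
      \<exists>A\<in>{A. A \<subseteq> {1..n} - S \<and> card A = a}.
      {e \<in> all_edges d n. e \<inter> S = {} \<and> e \<inter> A \<noteq> {} \<and> \<not> e \<subseteq> A} \<inter> set (take (m_lo d n) xs) = {})"
  shows "k_connected k {1..n} (set (take j xs))"
proof (rule k_connected_between[where ?E0.0 = "set (take (m_lo d n) xs)" and ?E1.0 = "set (take (m_hi n) xs)"
      and d = d and L = L and x = "real n / ln (real n)"])
  define E1 where "E1 = set (take (m_hi n) xs)"
  have sub: "set (take i xs) \<subseteq> all_edges d n" for i
    using set_take_subset_permutation[OF xs] .
  have star: "e \<in> star d n u" if "e \<in> E1" "u \<in> e" for e u
    using that sub[of "m_hi n"] by (auto simp: star_def E1_def)
  show "set (take (m_lo d n) xs) \<subseteq> set (take j xs)" "set (take j xs) \<subseteq> set (take (m_hi n) xs)"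
    using m by (auto intro!: set_take_subset_set_take)
  show "e \<subseteq> {1..n} \<and> card e = d" if "e \<in> set (take (m_hi n) xs)" for e
    using sub[of "m_hi n"] that by (auto simp: all_edges_def)
  fix u w assume uw: "u \<in> {1..n}" "w \<in> {1..n}" "u \<noteq> w"
  define P where "P = {e \<in> E1. u \<in> e \<and> w \<in> e}"
  have fP: "finite P" by (simp add: P_def E1_def)
  have P: "e \<in> star d n u \<inter> star d n w" "e \<in> set (take (m_hi n) xs)" if "e \<in> P" for e
    using that star by (auto simp: P_def E1_def)
  have "card P \<le> 2"
  proof (rule ccontr)
    assume "\<not> card P \<le> 2"
    then have "3 \<le> card P" by simp
    then obtain T where T: "T \<subseteq> P" "card T = 3" using obtain_subset_with_card_n by metis
    then obtain e f g where "T = {e, f, g}" "e \<noteq> f" "e \<noteq> g" "f \<noteq> g"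
      by (auto simp: card_3_iff)
    then have "e \<in> P" "f \<in> P - {e}" "g \<in> P - {e, f}" using T(1) by auto
    then show False
      using P uw
      by - (rule notE[OF codegree], rule bexI[of _ u], rule bexI[of _ w], rule bexI[of _ e],
          rule bexI[of _ f], rule bexI[of _ g], auto)
  qed
  then show "card {e \<in> set (take (m_hi n) xs). u \<in> e \<and> w \<in> e} \<le> 2" by (simp add: P_def E1_def)
  show "card {e \<in> set (take (m_hi n) xs). u \<in> e \<and> w \<in> e} \<le> 1"
    if low: "hg_degree (set (take (m_lo d n) xs)) u < L"
  proof -
    have "e = f" if "e \<in> P" "f \<in> P" for e f
    proof (rule ccontr)
      assume "e \<noteq> f"
      then show False
        using low P that uw
        by - (rule notE[OF low_codegree], rule bexI[of _ u], rule bexI[of _ w], rule bexI[of _ e],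
            rule bexI[of _ f], auto)
    qed
    then have "card P \<le> 1" using card_le_Suc0_iff_eq[OF fP] by auto
    then show ?thesis by (simp add: P_def E1_def)
  qed
  fix e f assume low: "hg_degree (set (take (m_lo d n) xs)) u < L" "hg_degree (set (take (m_lo d n) xs)) w < L"
    and ef: "e \<in> set (take (m_hi n) xs)" "f \<in> set (take (m_hi n) xs)" "u \<in> e" "w \<in> f"
  \<comment> \<open>Excluding a common edge first gives \<open>w \<notin> e\<close> and
    \<open>u \<notin> f\<close>. Hence a common vertex of \<open>e\<close> and \<open>f\<close> is a
    third vertex and the edges differ, as \<open>low_distance_two\<close> requires.\<close>
  have not_adjacent: "\<not> (u \<in> e' \<and> w \<in> e')" if "e' \<in> set (take (m_hi n) xs)" for e'
    using low_adjacent low uw that star[of e'] unfolding E1_def by blast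
  show "e \<inter> f = {}"
  proof (rule ccontr)
    assume "e \<inter> f \<noteq> {}"
    then obtain x where x: "x \<in> e" "x \<in> f" by blast
    have "w \<notin> e" "u \<notin> f" using not_adjacent ef by blast+
    then have "x \<noteq> u" "x \<noteq> w" "f \<noteq> e" using x ef by blast+
    moreover have "x \<in> {1..n}" using x(1) subsetD[OF sub ef(1)] unfolding all_edges_def by blast
    moreover have "e \<in> star d n u \<inter> star d n x" "f \<in> star d n w \<inter> star d n x"
      using star ef x by (auto simp: E1_def)
    ultimately show False
      using low uw ef
      by - (rule notE[OF low_distance_two], rule bexI[of _ u], rule bexI[of _ w], rule bexI[of _ x],
          rule bexI[of _ e], rule bexI[of _ f], auto)
  qed
next
  fix A assume A: "A \<subseteq> {1..n}" "A \<noteq> {}" "card A \<le> real n / ln (real n)"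
  show "card {e \<in> set (take (m_hi n) xs). e \<subseteq> A} < 2 * card A"
  proof (rule ccontr)
    assume "\<not> ?thesis"
    then have "2 * card A \<le> card {e \<in> set (take (m_hi n) xs). e \<subseteq> A}" by simp
    then obtain J where J: "J \<subseteq> {e \<in> set (take (m_hi n) xs). e \<subseteq> A}" "card J = 2 * card A" "finite J"
      by (rule obtain_subset_with_card_n)
    have "J \<subseteq> {e. e \<subseteq> A \<and> card e = d}"
      using J(1) set_take_subset_permutation[OF xs, of "m_hi n"] unfolding all_edges_def by blast
    moreover have "card A \<in> {1..nat \<lfloor>real n / ln (real n)\<rfloor>}"
    proof -
      have "finite A" using A(1) finite_atLeastAtMost by (rule finite_subset)
      then have "1 \<le> card A" using A(2) by (simp add: Suc_le_eq card_gt_0_iff)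
      then show ?thesis using le_nat_floor[OF A(3)] by simp
    qed
    ultimately show False
      using A(1) J
      by - (rule notE[OF dense], rule bexI[of _ "card A"], rule bexI[of _ A], rule bexI[of _ J], auto)
  qed
next
  fix A S assume S: "S \<subseteq> {1..n}" "card S = k - 1" and A: "A \<subseteq> {1..n} - S"
    "real n / ln (real n) < card A" "2 * card A \<le> card ({1..n} - S)"
  have "card ({1..n} - S) = n - (k - 1)"
    using S finite_subset[of S "{1..n}"] by (simp add: card_Diff_subset)
  \<comment> \<open>Guarantees that \<open>A\<close> is nonempty, since the sizes in
    \<open>separated\<close> start at 1.\<close>
  moreover have "0 \<le> real n / ln (real n)" using n by simp
  then have "1 \<le> card A" using A(2) by linarith
  ultimately have "card A \<in> {a\<in>{1..n}. real n / ln (real n) < real a \<and> 2 * a \<le> n - (k - 1)}"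
    using A by auto
  then have "{e \<in> all_edges d n. e \<inter> S = {} \<and> e \<inter> A \<noteq> {} \<and> \<not> e \<subseteq> A} \<inter> set (take (m_lo d n) xs) \<noteq> {}"
    using S A(1)
    by - (rule notI, rule notE[OF separated], rule bexI[of _ S], rule bexI[of _ "card A"],
        rule bexI[of _ A], auto)
  then show "\<exists>e\<in>set (take (m_lo d n) xs). e \<inter> S = {} \<and> e \<inter> A \<noteq> {} \<and> \<not> e \<subseteq> A"
    by blast
qed (use dk n deg in \<open>simp_all add: L_def\<close>)

theorem theorem1:
  fixes d k :: nat
  assumes "d \<ge> 3" and "k \<ge> 1"
  shows "(\<lambda>n. measure_pmf.prob (hypergraph_process d n) {es. tau k n es = T_conn k n es})
           \<longlonglongrightarrow> 1"
proof -
  have d: "2 \<le> d" using assms by simp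
  define L where "L = 3 * d + 2 * k"
  define B1 where "B1 = (\<lambda>n xs. \<forall>v\<in>{1..n}. star d n v \<inter> set (take (m_lo d n) xs) \<noteq> {})"
  define B2 where "B2 = (\<lambda>n xs. \<exists>v\<in>{1..n}. hg_degree (set (take (m_hi n) xs)) v < k)"
  define B3 where "B3 = (\<lambda>n xs. \<exists>u\<in>{1..n}. \<exists>w\<in>{1..n} - {u}.
      \<exists>e\<in>star d n u \<inter> star d n w. \<exists>f\<in>star d n u \<inter> star d n w - {e}.
      \<exists>g\<in>star d n u \<inter> star d n w - {e, f}. {e, f, g} \<subseteq> set (take (m_hi n) xs))"
  define B4 where "B4 = (\<lambda>n xs. \<exists>u\<in>{1..n}. \<exists>w\<in>{1..n} - {u}.
      \<exists>e\<in>star d n u \<inter> star d n w. \<exists>f\<in>star d n u \<inter> star d n w - {e}.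
      {e, f} \<subseteq> set (take (m_hi n) xs) \<and> hg_degree (set (take (m_lo d n) xs)) u < L)"
  define B5 where "B5 = (\<lambda>n xs. \<exists>u\<in>{1..n}. \<exists>v\<in>{1..n} - {u}.
      \<exists>e\<in>star d n u \<inter> star d n v. {e} \<subseteq> set (take (m_hi n) xs) \<and>
      hg_degree (set (take (m_lo d n) xs)) u < L \<and> hg_degree (set (take (m_lo d n) xs)) v < L)"
  define B6 where "B6 = (\<lambda>n xs. \<exists>u\<in>{1..n}. \<exists>v\<in>{1..n} - {u}. \<exists>w\<in>{1..n} - {u, v}.
      \<exists>e\<in>star d n u \<inter> star d n w. \<exists>f\<in>star d n v \<inter> star d n w - {e}. {e, f} \<subseteq> set (take (m_hi n) xs) \<and>
      hg_degree (set (take (m_lo d n) xs)) u < L \<and> hg_degree (set (take (m_lo d n) xs)) v < L)"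
  define B7 where "B7 = (\<lambda>n xs. \<exists>a\<in>{1..nat \<lfloor>real n / ln (real n)\<rfloor>}.
      \<exists>A\<in>{A. A \<subseteq> {1..n} \<and> card A = a}. \<exists>J\<in>{J. J \<subseteq> {e. e \<subseteq> A \<and> card e = d} \<and> card J = 2 * a}.
      J \<subseteq> set (take (m_hi n) xs))"
  define B8 where "B8 = (\<lambda>n xs. \<exists>S\<in>{S. S \<subseteq> {1..n} \<and> card S = k - 1}.
      \<exists>a\<in>{a\<in>{1..n}. real n / ln (real n) < real a \<and> 2 * a \<le> n - (k - 1)}.
      \<exists>A\<in>{A. A \<subseteq> {1..n} - S \<and> card A = a}.
      {e \<in> all_edges d n. e \<inter> S = {} \<and> e \<inter> A \<noteq> {} \<and> \<not> e \<subseteq> A} \<inter> set (take (m_lo d n) xs) = {})"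
  note defs = B1_def B2_def B3_def B4_def B5_def B6_def B7_def B8_def
  \<comment> \<open>Kept as a list so that one union bound over the indices below 8 covers all
    events.\<close>
  define Bad where "Bad = (\<lambda>n. [B1 n, B2 n, B3 n, B4 n, B5 n, B6 n, B7 n, B8 n])"

  have good: "tau k n xs = T_conn k n xs"
    if n: "k < n" and xs: "xs \<in> permutations_of_set (all_edges d n)"
      and m: "m_lo d n \<le> m_hi n" "m_hi n \<le> n choose d"
      and none: "\<forall>B\<in>set (Bad n). \<not> B xs" for n xs
  proof -
    have V: "finite {1..n}" "{1..n} \<noteq> {}" using n by auto
    have sub: "set (take i xs) \<subseteq> all_edges d n" for i
      using set_take_subset_permutation[OF xs] .
    have ok: "\<not> B1 n xs" "\<not> B2 n xs" "\<not> B3 n xs" "\<not> B4 n xs" "\<not> B5 n xs" "\<not> B6 n xs" "\<not> B7 n xs" "\<not> B8 n xs"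
      using none by (simp_all add: Bad_def)
    show ?thesis
      unfolding tau_def T_conn_def
    proof (rule first_time_eqI[where r = "m_lo d n" and m = "m_hi n"])
      show "m_hi n \<le> length xs"
        using xs m by (simp add: length_finite_permutations_of_set card_all_edges)
      show "k \<le> hg_min_degree {1..n} (hypergraph_at xs (m_hi n))"
        using ok(2) V unfolding hypergraph_at_def B2_def hg_min_degree_ge_iff[OF V]
        by (simp add: not_less)
      \<comment> \<open>A vertex isolated at the lower time was isolated at every earlier time, so
        its degree 0 is below \<open>k\<close> throughout.\<close>
      show "\<not> k \<le> hg_min_degree {1..n} (hypergraph_at xs j)" if j: "j \<le> m_lo d n" for j
      proof -
        obtain v where v: "v \<in> {1..n}" "star d n v \<inter> set (take (m_lo d n) xs) = {}"
          using ok(1) by (auto simp: B1_def)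
        have "set (take j xs) \<inter> star d n v = {}"
          using v(2) set_take_subset_set_take[OF j, of xs] by blast
        then have "hg_degree (set (take j xs)) v = 0"
          unfolding hg_degree_eq_card_Int_star[OF sub] by simp
        then show ?thesis
          using v(1) assms(2) unfolding hypergraph_at_def hg_min_degree_ge_iff[OF V] by force
      qed
      show "k_connected k {1..n} (hypergraph_at xs j)"
        if j: "m_lo d n \<le> j" "j \<le> m_hi n" "k \<le> hg_min_degree {1..n} (hypergraph_at xs j)" for j
        unfolding hypergraph_at_def
      proof (rule k_connected_process[OF assms n j(1,2) xs _ ok(3-8)[unfolded defs L_def]])
        show "k \<le> hg_degree (set (take j xs)) v" if "v \<in> {1..n}" for v
          using j(3) that unfolding hypergraph_at_def hg_min_degree_ge_iff[OF V] by blast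
      qed
      show "k \<le> hg_min_degree {1..n} (hypergraph_at xs j)"
        if "k_connected k {1..n} (hypergraph_at xs j)" for j
      proof (rule k_connected_imp_min_degree[OF V(1) _ _ that assms(2)])
        show "e \<subseteq> {1..n} \<and> 2 \<le> card e" if "e \<in> hypergraph_at xs j" for e
          using sub[of j] that d by (auto simp: hypergraph_at_def all_edges_def)
      qed (simp add: hypergraph_at_def)
    qed
  qed

  have "(\<lambda>n. \<Sum>i<8. perm_prob (all_edges d n) (Bad n ! i)) \<longlonglongrightarrow> (\<Sum>i<(8::nat). 0)"
  proof (rule tendsto_sum)
    fix i :: nat assume "i \<in> {..<8}"
    then have "i \<in> {0, 1, 2, 3, 4, 5, 6, 7}" by auto
    moreover have
      "(\<lambda>n. perm_prob (all_edges d n) (B1 n)) \<longlonglongrightarrow> 0"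
      "(\<lambda>n. perm_prob (all_edges d n) (B2 n)) \<longlonglongrightarrow> 0"
      "(\<lambda>n. perm_prob (all_edges d n) (B3 n)) \<longlonglongrightarrow> 0"
      "(\<lambda>n. perm_prob (all_edges d n) (B4 n)) \<longlonglongrightarrow> 0"
      "(\<lambda>n. perm_prob (all_edges d n) (B5 n)) \<longlonglongrightarrow> 0"
      "(\<lambda>n. perm_prob (all_edges d n) (B6 n)) \<longlonglongrightarrow> 0"
      "(\<lambda>n. perm_prob (all_edges d n) (B7 n)) \<longlonglongrightarrow> 0"
      "(\<lambda>n. perm_prob (all_edges d n) (B8 n)) \<longlonglongrightarrow> 0"
      unfolding defs
      by (rule prob_no_isolated_tendsto_0[OF d] prob_small_degree_m_hi_tendsto_0[OF d]
        prob_codegree_tendsto_0[OF d] prob_low_codegree_tendsto_0[OF d]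
        prob_low_adjacent_tendsto_0[OF d] prob_low_distance_two_tendsto_0[OF d]
        prob_dense_tendsto_0[OF assms(1)] prob_separated_tendsto_0[OF d assms(2)])+
    ultimately show "(\<lambda>n. perm_prob (all_edges d n) (Bad n ! i)) \<longlonglongrightarrow> 0"
      by (auto simp: Bad_def)
  qed
  then have lim: "(\<lambda>n. \<Sum>i<8. perm_prob (all_edges d n) (Bad n ! i)) \<longlonglongrightarrow> 0" by simp
  have "\<forall>\<^sub>F n in sequentially. m_lo d n \<le> m_hi n"
    using d by (intro eventually_m_lo_le_m_hi) auto
  then have "\<forall>\<^sub>F n in sequentially. perm_prob (all_edges d n) (\<lambda>xs. \<not> tau k n xs = T_conn k n xs) \<le>
      (\<Sum>i<8. perm_prob (all_edges d n) (Bad n ! i))"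
    using eventually_m_hi_le[OF d] eventually_gt_at_top[of k]
  proof eventually_elim
    case (elim n)
    have "perm_prob (all_edges d n) (\<lambda>xs. \<not> tau k n xs = T_conn k n xs) \<le>
        perm_prob (all_edges d n) (\<lambda>xs. \<exists>i\<in>{..<8}. (Bad n ! i) xs)"
    proof (rule perm_prob_mono)
      fix xs assume xs: "xs \<in> permutations_of_set (all_edges d n)" and ne: "\<not> tau k n xs = T_conn k n xs"
      then obtain B where "B \<in> set (Bad n)" "B xs" using good[OF elim(3) xs elim(1,2)] by blast
      moreover have "length (Bad n) = 8" by (simp add: Bad_def)
      ultimately show "\<exists>i\<in>{..<8}. (Bad n ! i) xs" by (metis in_set_conv_nth lessThan_iff)
    qed
    also have "\<dots> \<le> (\<Sum>i<8. perm_prob (all_edges d n) (Bad n ! i))"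
      by (intro perm_prob_Bex) simp
    finally show ?case .
  qed
  then have "(\<lambda>n. perm_prob (all_edges d n) (\<lambda>xs. \<not> tau k n xs = T_conn k n xs)) \<longlonglongrightarrow> 0"
    using lim by (rule perm_prob_tendsto_0)
  then have "(\<lambda>n. 1 - perm_prob (all_edges d n) (\<lambda>xs. \<not> tau k n xs = T_conn k n xs)) \<longlonglongrightarrow> 1 - 0"
    by (intro tendsto_intros)
  then show ?thesis
    by (simp add: prob_hypergraph_process perm_prob_not)
qed

end
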